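(* Let $m$ be a fixed positive integer, $p\in[1/2,1)$, $q=1-p$ and $\rho=p/q$. The asymptotic probability (as $n\to\infty$) that a random tournament with ties $t$ within the Erdős–Rényi model $T(n,p)$ has $m$ strongly connected components satisfies $$\mathbb P(t\text{ has }m\text{ strongly connected components})\approx\sum_{k\ge0}Q_{k,m}(\rho)\cdot\binom nk\cdot\frac{q^{nk}}{q^{k(k+1)/2}},$$ where $$Q_{k,m}(\rho)=m\Big(\mathfrak{it}^{(m-1)}_k-2\,\mathfrak{it}^{(m)}_k+\mathfrak{it}^{(m+1)}_k\Big).$$ In particular, $$\mathbb P(t\text{ is strongly connected})\approx1-\sum_{k\ge0}\Big(2\,\mathfrak{it}^{(1)}_k-\mathfrak{it}^{(2)}_k\Big)\cdot\binom nk\cdot\frac{q^{nk}}{q^{k(k+1)/2}}.$$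
   Context: A tournament with ties on $[n]=\{1,\dots,n\}$ is a directed graph with vertex set $[n]$ in which every pair of distinct vertices is joined either by exactly one directed edge or by two oppositely directed edges. For $p\in[1/2,1]$, in the Erdős–Rényi model $T(n,p)$ each pair of vertices $i\ne j$ is joined, independently of other pairs, by a single edge from $i$ to $j$ with probability $q$, by a single edge from $j$ to $i$ with probability $q$, and by two edges (both directions) with probability $p-q$. The weight of a tournament with ties $t$ is $w(t)=(\rho-1)^{\ell}$, where $\ell$ is the number of pairs of vertices joined by two edges (with $0^0=1$). For $j\ge1$, $\mathfrak{it}^{(j)}_k=\mathfrak{it}^{(j)}_k(\rho)$ is the sum of the weights of all tournaments with ties on $[k]$ having exactly $j$ strongly connected components (so $\mathfrak{it}^{(j)}_0=0$); by convention $\mathfrak{it}^{(0)}_0=1$ and $\mathfrak{it}^{(0)}_k=0$ for $k>0$. Notation $\approx$: $p_n\approx\sum_{k\ge0}c_kg_k(n)$ (here $g_k(n)=\binom nk q^{nk-k(k+1)/2}$) means that $g_{k+1}(n)=o(g_k(n))$ for every $k$ and, for every integer $r\ge0$, $p_n=\sum_{k=0}^rc_kg_k(n)+O(g_{r+1}(n))$ as $n\to\infty$; the constant $1$ in the second expansion belongs to the $k=0$ term. *)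

theory Defs
  imports
    "HOL-Probability.Probability"
    "HOL-Library.Landau_Symbols"
    "Graph_Theory.Digraph_Component"
begin

definition tournament_with_ties :: "nat \<Rightarrow> nat pair_pre_digraph \<Rightarrow> bool" where
  "tournament_with_ties n t \<longleftrightarrow>
     pverts t = {1..n} \<and>
     parcs t \<subseteq> {1..n} \<times> {1..n} \<and>
     (\<forall>i. (i, i) \<notin> parcs t) \<and>
     (\<forall>i\<in>{1..n}. \<forall>j\<in>{1..n}. i \<noteq> j \<longrightarrow> (i, j) \<in> parcs t \<or> (j, i) \<in> parcs t)"

definition num_sccs :: "nat pair_pre_digraph \<Rightarrow> nat" where
  "num_sccs t = card (pre_digraph.sccs (with_proj t))"

definition num_ties :: "nat pair_pre_digraph \<Rightarrow> nat" where
  "num_ties t = card {(i, j). i < j \<and> (i, j) \<in> parcs t \<and> (j, i) \<in> parcs t}"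

definition tournament_weight :: "real \<Rightarrow> nat pair_pre_digraph \<Rightarrow> real" where
  "tournament_weight \<rho> t = (\<rho> - 1) ^ num_ties t"

definition tournament_weight_sum :: "real \<Rightarrow> nat \<Rightarrow> nat \<Rightarrow> real" (\<open>\<ii>\<tt>\<close>) where
  "\<ii>\<tt> \<rho> j k =
     (if j = 0 then (if k = 0 then 1 else 0)
      else (\<Sum>t | tournament_with_ties k t \<and> num_sccs t = j. tournament_weight \<rho> t))"

text \<open>
  The random set of arcs joining \<open>i\<close> and \<open>j\<close>. The probabilities add up to 1 because
  \<open>q + q + (p - q) = p + q = 1\<close>, and are nonnegative iff \<open>1/2 \<le> p \<le> 1\<close>;
  \<^const>\<open>pmf_of_list\<close> is meaningful only in that range.
\<close>

definition random_arcs :: "real \<Rightarrow> nat \<Rightarrow> nat \<Rightarrow> (nat \<times> nat) set pmf" where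
  "random_arcs p i j =
     (let q = 1 - p in
      pmf_of_list [({(i, j)}, q), ({(j, i)}, q), ({(i, j), (j, i)}, p - q)])"

lemma random_arcs_wf:
  fixes p :: real and i j :: nat
  assumes "1/2 \<le> p" "p \<le> 1"
  shows "pmf_of_list_wf
           [({(i, j)}, 1 - p), ({(j, i)}, 1 - p), ({(i, j), (j, i)}, p - (1 - p))]"
  using assms by (intro pmf_of_list_wfI) auto

definition vertex_pairs :: "nat \<Rightarrow> (nat \<times> nat) set" where
  "vertex_pairs n = {(i, j). 1 \<le> i \<and> i < j \<and> j \<le> n}"

text \<open>
  The model \<open>T(n,p)\<close>: \<^const>\<open>Pi_pmf\<close> chooses the arcs of the different unordered pairs of
  vertices independently.
\<close>

definition random_tournament :: "nat \<Rightarrow> real \<Rightarrow> nat pair_pre_digraph pmf" where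
  "random_tournament n p =
     map_pmf (\<lambda>f. \<lparr>pverts = {1..n}, parcs = (\<Union>e\<in>vertex_pairs n. f e)\<rparr>)
       (Pi_pmf (vertex_pairs n) {} (\<lambda>(i, j). random_arcs p i j))"

definition has_expansion ::
  "(nat \<Rightarrow> real) \<Rightarrow> (nat \<Rightarrow> real) \<Rightarrow> (nat \<Rightarrow> nat \<Rightarrow> real) \<Rightarrow> bool" where
  "has_expansion a c g \<longleftrightarrow>
     (\<forall>k. g (Suc k) \<in> o(g k)) \<and>
     (\<forall>r. (\<lambda>n. a n - (\<Sum>k\<le>r. c k * g k n)) \<in> O(g (Suc r)))"

definition expansion_scale :: "real \<Rightarrow> nat \<Rightarrow> nat \<Rightarrow> real" where
  "expansion_scale q k n = real (n choose k) * (q ^ (n * k) / q ^ (k * (k + 1) div 2))"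

definition scc_coeff :: "real \<Rightarrow> nat \<Rightarrow> nat \<Rightarrow> real" where
  "scc_coeff \<rho> m k = real m * (\<ii>\<tt> \<rho> (m - 1) k - 2 * \<ii>\<tt> \<rho> m k + \<ii>\<tt> \<rho> (m + 1) k)"

end

theory Submission
  imports
    Defs
    "HOL-Computational_Algebra.Formal_Power_Series"
    "HOL-Real_Asymp.Real_Asymp"
begin

text \<open>
  Let \<open>T\<close> and \<open>I\<close> be the exponential generating functions of the weights of all, and of all
  strongly connected, tournaments with ties. Splitting off the component that reaches every vertex
  gives \<open>T = 1 + I T\<close>, and \<open>I ^ m\<close> counts the tournaments with \<open>m\<close> components. The \<open>n\<close>-th
  coefficient \<open>T\<^sub>n = 1 / (q ^ (n choose 2) n!)\<close> grows so fast that in a product of two series bounded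
  by \<open>T\<close> only the first and last few terms of each convolution matter. Hence the map \<open>A \<mapsto> C\<close> sending
  \<open>A\<close> to the series with \<open>A\<^sub>n \<approx> \<Sum>k. C\<^sub>k T\<^bsub>n-k\<^esub>\<close> is a derivation with \<open>T \<mapsto> 1\<close>. From \<open>(1 - I) T = 1\<close>
  one gets \<open>I \<mapsto> (1 - I)\<^sup>2\<close> and \<open>I ^ m \<mapsto> m I ^ (m - 1) (1 - I)\<^sup>2\<close>, whose coefficients
  are \<open>Q\<^bsub>k,m\<^esub> / k!\<close>; dividing by \<open>T\<^sub>n\<close> turns \<open>T\<^bsub>n-k\<^esub> / k!\<close> into the asymptotic scale.
\<close>

unbundle no vec_syntax
unbundle fps_syntax

subsection \<open>Asymptotics of products of rapidly growing series\<close>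

text \<open>Log-convexity makes the products \<open>T $ k * T $ (n - k)\<close> decrease as
  \<open>k\<close> approaches the middle, and \<open>growth\<close> lets one step of the index
  absorb linearly many terms. With constant term 1, the series \<open>T - 1\<close> starts at index
  1.\<close>

locale fast_growing_fps =
  fixes T :: "real fps"
  assumes pos: "T $ n > 0"
    and zeroth: "T $ 0 = 1"
    and log_convex: "(T $ Suc n)\<^sup>2 \<le> T $ n * T $ Suc (Suc n)"
    and growth: "(\<lambda>n. real n * T $ n) \<in> O(\<lambda>n. T $ Suc n)"
begin

lemma ratio_mono: "i \<le> j \<Longrightarrow> T $ Suc i / T $ i \<le> T $ Suc j / T $ j"
proof (induction j rule: dec_induct)
  case (step j)
  have "T $ Suc j / T $ j \<le> T $ Suc (Suc j) / T $ Suc j"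
    using log_convex[of j] pos[of j] pos[of "Suc j"]
    by (simp add: field_simps power2_eq_square)
  with step show ?case by simp
qed simp

text \<open>One step of \<open>k\<close> towards the middle multiplies the product by the ratio at
  \<open>k\<close> divided by the ratio at \<open>n - Suc k\<close>. This is at most 1 by
  \<open>ratio_mono\<close>, because \<open>k \<le> n - Suc k\<close>.\<close>

lemma prod_antimono:
  assumes "s \<le> k" "2 * k \<le> n"
  shows "T $ k * T $ (n - k) \<le> T $ s * T $ (n - s)"
  using assms
proof (induction k rule: dec_induct)
  case (step k)
  define l where "l = n - Suc k"
  have l: "n - k = Suc l" "n - Suc k = l" "k \<le> l"
    using step.prems by (auto simp: l_def)
  have "T $ Suc k / T $ k \<le> T $ Suc l / T $ l"
    using l by (intro ratio_mono)
  then have "T $ Suc k * T $ l \<le> T $ k * T $ Suc l"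
    using pos[of k] pos[of l] by (simp add: field_simps)
  with step l show ?case by simp
qed simp

text \<open>The reflection \<open>k \<mapsto> n - k\<close> preserves the product and moves an index
  from the second half into the first.\<close>

lemma prod_le:
  assumes "s \<le> k" "k \<le> n - s" "2 * s \<le> n"
  shows "T $ k * T $ (n - k) \<le> T $ s * T $ (n - s)"
proof (cases "2 * k \<le> n")
  case True
  then show ?thesis using assms by (intro prod_antimono)
next
  case False
  have "T $ (n - k) * T $ (n - (n - k)) \<le> T $ s * T $ (n - s)"
    using False assms by (intro prod_antimono) auto
  with assms show ?thesis by (simp add: mult.commute)
qed

lemma bigo_shift:
  assumes "f \<in> O(g)"
  shows "(\<lambda>n. f (n - k)) \<in> O(\<lambda>n. g (n - k :: nat))"
  using assms by (rule landau_o.big.compose) (rule filterlim_minus_const_nat_at_top)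

lemma smallo_Suc: "(\<lambda>n. T $ n) \<in> o(\<lambda>n. T $ Suc n)"
proof -
  have "(\<lambda>n. 1 / real n) \<in> o(\<lambda>_. 1)" by real_asymp
  from landau_o.small_big_mult[OF this growth]
  have "(\<lambda>n. 1 / real n * (real n * T $ n)) \<in> o(\<lambda>n. T $ Suc n)" by simp
  also have "?this \<longleftrightarrow> ?thesis"
    by (intro landau_o.small.in_cong eventually_mono[OF eventually_gt_at_top[of 0]]) simp
  finally show ?thesis .
qed

lemma smallo_shift: "(\<lambda>n. T $ (n - Suc k)) \<in> o(\<lambda>n. T $ (n - k))"
proof -
  have "(\<lambda>n. T $ (n - Suc k)) \<in> o(\<lambda>n. T $ Suc (n - Suc k))"
    using smallo_Suc by (rule landau_o.small.compose) (rule filterlim_minus_const_nat_at_top)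
  also have "(\<lambda>n. T $ Suc (n - Suc k)) \<in> \<Theta>(\<lambda>n. T $ (n - k))"
    by (intro bigthetaI_cong eventually_mono[OF eventually_gt_at_top[of k]])
       (simp add: Suc_diff_Suc)
  finally show ?thesis .
qed

text \<open>Positivity of \<open>T\<close> extends the eventual bound to every index, as needed for
  convolutions, which always involve small indices.\<close>

lemma bounded_by_T:
  assumes "(\<lambda>n. A $ n) \<in> O(\<lambda>n. T $ n)"
  obtains C where "C > 0" "\<And>n. \<bar>A $ n\<bar> \<le> C * T $ n"
proof -
  obtain c where "eventually (\<lambda>n. norm (A $ n) \<le> c * norm (T $ n)) at_top"
    using assms by (elim landau_o.bigE)
  then have "eventually (\<lambda>n. norm (A $ n / T $ n) \<le> c) sequentially"
    by eventually_elim (use pos in \<open>simp add: abs_of_pos pos_divide_le_eq\<close>)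
  then have "Bseq (\<lambda>n. A $ n / T $ n)"
    by (rule BfunI)
  then obtain K where "K > 0" "\<And>n. norm (A $ n / T $ n) \<le> K"
    unfolding Bseq_def by blast
  with that[of K] pos show thesis by (simp add: abs_of_pos pos_divide_le_eq)
qed

text \<open>The two end terms equal \<open>T $ r * T $ (n - r)\<close>. Each of the fewer than
  \<open>n\<close> inner terms is at most \<open>T $ Suc r * T $ (n - Suc r)\<close>, and
  \<open>growth\<close> trades their number for one step of the index.\<close>

lemma middle_sum_bigo:
  "(\<lambda>n. \<Sum>k=r..n-r. T $ k * T $ (n - k)) \<in> O(\<lambda>n. T $ (n - r))"
proof -
  \<comment> \<open>The inner sum has \<open>n - 2 * r - 1\<close> terms; any constant factor that
    is at least 1 would serve in place of \<open>real r + 2\<close>.\<close>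
  let ?h = "\<lambda>n. 2 * (T $ r * T $ (n - r)) +
              (real r + 2) * T $ Suc r * (real (n - Suc r) * T $ (n - Suc r))"
  have "(\<lambda>n. real (n - Suc r) * T $ (n - Suc r)) \<in> O(\<lambda>n. T $ Suc (n - Suc r))"
    using growth by (rule bigo_shift)
  also have "(\<lambda>n. T $ Suc (n - Suc r)) \<in> \<Theta>(\<lambda>n. T $ (n - r))"
    by (intro bigthetaI_cong eventually_mono[OF eventually_gt_at_top[of r]])
       (simp add: Suc_diff_Suc)
  finally have "?h \<in> O(\<lambda>n. T $ (n - r))"
    by (intro sum_in_bigo(1)) (use pos[of r] pos[of "Suc r"] in \<open>simp_all add: mult.assoc\<close>)
  moreover have "(\<lambda>n. \<Sum>k=r..n-r. T $ k * T $ (n - k)) \<in> O(?h)"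
  proof (rule landau_o.bigI[of 1])
    show "eventually (\<lambda>n. norm (\<Sum>k=r..n-r. T $ k * T $ (n - k)) \<le> 1 * norm (?h n)) at_top"
      \<comment> \<open>From here on the indices \<open>r\<close> and \<open>n - r\<close> differ
        and \<open>prod_le\<close> applies with \<open>Suc r\<close>.\<close>
      using eventually_ge_at_top[of "2 * r + 2"]
    proof eventually_elim
      case (elim n)
      have split: "{r..n-r} = {r, n-r} \<union> {Suc r..n - Suc r}"
        using elim by auto
      have "(\<Sum>k=r..n-r. T $ k * T $ (n - k))
          = (\<Sum>k\<in>{r, n-r}. T $ k * T $ (n - k)) + (\<Sum>k=Suc r..n - Suc r. T $ k * T $ (n - k))"
        unfolding split by (rule sum.union_disjoint) (use elim in auto)
      also have "(\<Sum>k\<in>{r, n-r}. T $ k * T $ (n - k)) = 2 * (T $ r * T $ (n - r))"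
        using elim by (subst sum.insert) auto
      also have "(\<Sum>k=Suc r..n - Suc r. T $ k * T $ (n - k))
          \<le> (\<Sum>k=Suc r..n - Suc r. T $ Suc r * T $ (n - Suc r))"
        using elim by (intro sum_mono prod_le) auto
      also have "\<dots> = real (n - Suc r - r) * (T $ Suc r * T $ (n - Suc r))"
        by simp
      also have "real (n - Suc r - r) \<le> (real r + 2) * real (n - Suc r)"
      proof -
        have "real (n - Suc r - r) \<le> 1 * real (n - Suc r)" by simp
        also have "\<dots> \<le> (real r + 2) * real (n - Suc r)"
          by (intro mult_right_mono) auto
        finally show ?thesis .
      qed
      then have "real (n - Suc r - r) * (T $ Suc r * T $ (n - Suc r))
          \<le> (real r + 2) * real (n - Suc r) * (T $ Suc r * T $ (n - Suc r))"
        using pos by (intro mult_right_mono) (auto intro: less_imp_le)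
      finally have "(\<Sum>k=r..n-r. T $ k * T $ (n - k)) \<le> ?h n"
        by (simp add: mult_ac)
      moreover have "0 \<le> (\<Sum>k=r..n-r. T $ k * T $ (n - k))"
        using pos by (intro sum_nonneg mult_nonneg_nonneg) (auto intro: less_imp_le)
      ultimately show ?case by simp
    qed
  qed simp
  ultimately show ?thesis
    using landau_o.big.trans by blast
qed

text \<open>The two sums are the first and the last \<open>r\<close> terms of the convolution, the
  latter reversed. The terms between them are bounded by a constant times those of
  \<open>T * T\<close>.\<close>

lemma mult_split_bigo:
  assumes A: "(\<lambda>n. A $ n) \<in> O(\<lambda>n. T $ n)" and B: "(\<lambda>n. B $ n) \<in> O(\<lambda>n. T $ n)"
  shows "(\<lambda>n. (A * B) $ n - ((\<Sum>k<r. A $ k * B $ (n - k)) + (\<Sum>k<r. B $ k * A $ (n - k))))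
           \<in> O(\<lambda>n. T $ (n - r))"
proof -
  obtain C where C: "C > 0" "\<And>n. \<bar>A $ n\<bar> \<le> C * T $ n"
    using bounded_by_T[OF A] by blast
  obtain D where D: "D > 0" "\<And>n. \<bar>B $ n\<bar> \<le> D * T $ n"
    using bounded_by_T[OF B] by blast
  let ?m = "\<lambda>n. \<Sum>k=r..n-r. T $ k * T $ (n - k)"
  let ?d = "\<lambda>n. (A * B) $ n - ((\<Sum>k<r. A $ k * B $ (n - k)) + (\<Sum>k<r. B $ k * A $ (n - k)))"
  have "eventually (\<lambda>n. norm (?d n) \<le> (C * D) * norm (?m n)) at_top"
    \<comment> \<open>This makes the three index ranges below disjoint.\<close>
    using eventually_ge_at_top[of "2 * r"]
  proof eventually_elim
    case (elim n)
    have "(A * B) $ n = (\<Sum>k\<in>{..<r} \<union> {r..n-r} \<union> {n-r<..n}. A $ k * B $ (n - k))"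
      unfolding fps_mult_nth using elim by (intro sum.cong) auto
    also have "\<dots> = (\<Sum>k<r. A $ k * B $ (n - k)) + (\<Sum>k=r..n-r. A $ k * B $ (n - k))
        + (\<Sum>k\<in>{n-r<..n}. A $ k * B $ (n - k))"
      using elim by (subst sum.union_disjoint; (subst sum.union_disjoint)?) auto
    also have "(\<Sum>k\<in>{n-r<..n}. A $ k * B $ (n - k)) = (\<Sum>k<r. B $ k * A $ (n - k))"
      using elim
      by (intro sum.reindex_bij_witness[of _ "\<lambda>k. n - k" "\<lambda>k. n - k"]) auto
    finally have "norm (?d n) = \<bar>\<Sum>k=r..n-r. A $ k * B $ (n - k)\<bar>"
      by simp
    also have "\<dots> \<le> (\<Sum>k=r..n-r. \<bar>A $ k * B $ (n - k)\<bar>)"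
      by (rule sum_abs)
    also have "\<dots> \<le> (\<Sum>k=r..n-r. (C * T $ k) * (D * T $ (n - k)))"
      unfolding abs_mult using C D pos
      by (intro sum_mono mult_mono) (auto intro: less_imp_le)
    also have "\<dots> = (C * D) * ?m n"
      by (simp add: sum_distrib_left mult_ac)
    also have "\<dots> \<le> (C * D) * norm (?m n)"
      using C D by (intro mult_left_mono) auto
    finally show ?case .
  qed
  then have "?d \<in> O(?m)"
    using C D by (intro landau_o.bigI[of "C * D"]) auto
  then show ?thesis
    using middle_sum_bigo by (rule landau_o.big.trans)
qed

section \<open>Calculus of expansions: linearity, product, reciprocal and power rules\<close>

text \<open>The truncated subtraction \<open>n - k\<close> is harmless, as it affects only the finitely many \<open>n < r\<close>.\<close>

definition expands_upto :: "nat \<Rightarrow> real fps \<Rightarrow> real fps \<Rightarrow> bool" where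
  "expands_upto r A C \<longleftrightarrow>
     (\<lambda>n. A $ n - (\<Sum>k<r. C $ k * T $ (n - k))) \<in> O(\<lambda>n. T $ (n - r))"

lemma expands_upto_0: "expands_upto 0 A C \<longleftrightarrow> (\<lambda>n. A $ n) \<in> O(\<lambda>n. T $ n)"
  by (simp add: expands_upto_def)

text \<open>Expanding \<open>B $ (n - k)\<close> to order \<open>r - k\<close> leaves an error of
  order \<open>T $ (n - r)\<close> for each \<open>k\<close>, and grouping the main terms by
  \<open>l = k + j\<close> yields the coefficients of \<open>A * D\<close>. Restricting the premise
  to nonzero \<open>A $ k\<close> lets the reciprocal rule avoid the circular case
  \<open>k = 0\<close>.\<close>

lemma expands_upto_shifted_sum:
  assumes "\<And>k. k < r \<Longrightarrow> A $ k \<noteq> 0 \<Longrightarrow> expands_upto (r - k) B D"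
  shows "(\<lambda>n. (\<Sum>k<r. A $ k * B $ (n - k)) - (\<Sum>l<r. (A * D) $ l * T $ (n - l)))
           \<in> O(\<lambda>n. T $ (n - r))"
proof -
  have "(\<lambda>n. \<Sum>k<r. A $ k * (B $ (n - k) - (\<Sum>j<r - k. D $ j * T $ (n - k - j))))
      \<in> O(\<lambda>n. T $ (n - r))"
  proof (rule big_sum_in_bigo)
    fix k assume k: "k \<in> {..<r}"
    show "(\<lambda>n. A $ k * (B $ (n - k) - (\<Sum>j<r - k. D $ j * T $ (n - k - j))))
      \<in> O(\<lambda>n. T $ (n - r))"
    proof (cases "A $ k = 0")
      case False
      then have "(\<lambda>n. B $ (n - k) - (\<Sum>j<r - k. D $ j * T $ (n - k - j)))
          \<in> O(\<lambda>n. T $ (n - k - (r - k)))"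
        using assms[of k] k unfolding expands_upto_def by (intro bigo_shift) auto
      with k show ?thesis by (auto intro!: landau_o.big.mult_in_1)
    qed simp
  qed
  also have "(\<lambda>n. \<Sum>k<r. A $ k * (B $ (n - k) - (\<Sum>j<r - k. D $ j * T $ (n - k - j))))
    = (\<lambda>n. (\<Sum>k<r. A $ k * B $ (n - k)) - (\<Sum>l<r. (A * D) $ l * T $ (n - l)))"
  proof
    fix n
    \<comment> \<open>Writing \<open>l\<close> as \<open>k + (l - k)\<close> brings the summand into
      the shape of \<open>sum.triangle_reindex\<close>.\<close>
    have "(\<Sum>l<r. (A * D) $ l * T $ (n - l))
        = (\<Sum>l<r. \<Sum>k\<le>l. A $ k * D $ (l - k) * T $ (n - (k + (l - k))))"
      by (simp add: fps_mult_nth sum_distrib_right atMost_atLeast0)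
    also have "\<dots> = (\<Sum>(k,j)\<in>{(k,j). k + j < r}. A $ k * D $ j * T $ (n - (k + j)))"
      by (rule sum.triangle_reindex[symmetric])
    also have "{(k,j). k + j < r} = (SIGMA k:{..<r}. {..<r-k})"
      by auto
    also have "(\<Sum>(k,j)\<in>\<dots>. A $ k * D $ j * T $ (n - (k + j)))
        = (\<Sum>k<r. \<Sum>j<r-k. A $ k * D $ j * T $ (n - (k + j)))"
      by (subst sum.Sigma) auto
    finally show "(\<Sum>k<r. A $ k * (B $ (n - k) - (\<Sum>j<r - k. D $ j * T $ (n - k - j))))
      = (\<Sum>k<r. A $ k * B $ (n - k)) - (\<Sum>l<r. (A * D) $ l * T $ (n - l))"
      by (simp add: algebra_simps sum_subtractf sum_distrib_left)
  qed
  finally show ?thesis .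
qed

text \<open>Leibniz rule: the first terms of the convolution are expanded through \<open>B\<close>,
  the last ones through \<open>A\<close>.\<close>

lemma expands_upto_mult:
  assumes A: "\<And>r. expands_upto r A C" and B: "\<And>r. expands_upto r B D"
  shows "expands_upto r (A * B) (A * D + B * C)"
proof -
  have "(\<lambda>n. (A * B) $ n - ((\<Sum>k<r. A $ k * B $ (n - k)) + (\<Sum>k<r. B $ k * A $ (n - k))))
      \<in> O(\<lambda>n. T $ (n - r))"
    using A[of 0] B[of 0] unfolding expands_upto_0 by (rule mult_split_bigo)
  moreover have "(\<lambda>n. (\<Sum>k<r. A $ k * B $ (n - k)) - (\<Sum>l<r. (A * D) $ l * T $ (n - l)))
      \<in> O(\<lambda>n. T $ (n - r))"
    using B by (rule expands_upto_shifted_sum)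
  moreover have "(\<lambda>n. (\<Sum>k<r. B $ k * A $ (n - k)) - (\<Sum>l<r. (B * C) $ l * T $ (n - l)))
      \<in> O(\<lambda>n. T $ (n - r))"
    using A by (rule expands_upto_shifted_sum)
  ultimately have "(\<lambda>n. (A * B) $ n - ((\<Sum>k<r. A $ k * B $ (n - k)) + (\<Sum>k<r. B $ k * A $ (n - k)))
        + ((\<Sum>k<r. A $ k * B $ (n - k)) - (\<Sum>l<r. (A * D) $ l * T $ (n - l)))
        + ((\<Sum>k<r. B $ k * A $ (n - k)) - (\<Sum>l<r. (B * C) $ l * T $ (n - l))))
      \<in> O(\<lambda>n. T $ (n - r))"
    by (intro sum_in_bigo(1))
  also have "?this \<longleftrightarrow> ?thesis"
    unfolding expands_upto_def
    by (intro arg_cong[of _ _ "\<lambda>f. f \<in> _"] ext) (simp add: distrib_right sum.distrib)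
  finally show ?thesis .
qed

lemma expands_upto_diff:
  assumes "expands_upto r A C" "expands_upto r B D"
  shows "expands_upto r (A - B) (C - D)"
proof -
  have "(\<lambda>n. A $ n - (\<Sum>k<r. C $ k * T $ (n - k)) - (B $ n - (\<Sum>k<r. D $ k * T $ (n - k))))
      \<in> O(\<lambda>n. T $ (n - r))"
    using assms unfolding expands_upto_def by (rule sum_in_bigo(2))
  then show ?thesis
    unfolding expands_upto_def
    by (elim back_subst[of "\<lambda>f. f \<in> _"], intro ext)
       (simp add: left_diff_distrib sum_subtractf)
qed

lemma expands_upto_1: "expands_upto r 1 0"
proof -
  have "eventually (\<lambda>n. (1 :: real fps) $ n - (\<Sum>k<r. 0 $ k * T $ (n - k)) = 0) at_top"
    using eventually_gt_at_top[of 0] by eventually_elim auto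
  then show ?thesis
    unfolding expands_upto_def by (subst landau_o.big.in_cong) (auto intro: always_eventually)
qed

text \<open>For positive \<open>r\<close> the term \<open>k = 0\<close> reproduces
  \<open>T $ n\<close> and the error is zero; for \<open>r = 0\<close> the error is
  \<open>T $ n\<close> itself, which is within the allowed bound.\<close>

lemma expands_upto_T: "expands_upto r T 1"
proof (cases r)
  case (Suc s)
  have "T $ n - (\<Sum>k<r. 1 $ k * T $ (n - k)) = 0" for n
    unfolding Suc by (subst sum.lessThan_Suc_shift) simp
  then show ?thesis by (simp only: expands_upto_def zero_in_bigo)
qed (simp add: expands_upto_0)

text \<open>Quotient rule for a derivation that sends \<open>T\<close> to 1. The bound
  \<open>bd\<close> starts the induction and permits splitting the product.\<close>

lemma expands_upto_reciprocal:
  assumes inv: "W * T = 1" and bd: "(\<lambda>n. W $ n) \<in> O(\<lambda>n. T $ n)"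
  shows "expands_upto r W (- (W\<^sup>2))"
proof (induction r rule: less_induct)
  case (less r)
  \<comment> \<open>We expand \<open>W (T - 1) = 1 - W\<close>: since \<open>T - 1\<close> has no constant term, only expansions of \<open>W\<close> of
    order less than \<open>r\<close> enter on the left.\<close>
  show ?case
  proof (cases r)
    case 0
    with bd show ?thesis by (simp add: expands_upto_0)
  next
    case (Suc s)
    have "(\<lambda>n. (W * (T - 1)) $ n - ((\<Sum>k<r. W $ k * (T - 1) $ (n - k)) +
             (\<Sum>k<r. (T - 1) $ k * W $ (n - k)))) \<in> O(\<lambda>n. T $ (n - r))"
      using bd
      by (rule mult_split_bigo)
         (use expands_upto_1[of 0] in \<open>auto intro!: sum_in_bigo simp: expands_upto_0\<close>)
    moreover have "(\<lambda>n. (\<Sum>k<r. W $ k * (T - 1) $ (n - k))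
        - (\<Sum>l<r. (W * 1) $ l * T $ (n - l))) \<in> O(\<lambda>n. T $ (n - r))"
    proof (rule expands_upto_shifted_sum)
      show "expands_upto (r - k) (T - 1) 1" for k
        using expands_upto_diff[OF expands_upto_T expands_upto_1] by simp
    qed
    moreover have "(\<lambda>n. (\<Sum>k<r. (T - 1) $ k * W $ (n - k))
        - (\<Sum>l<r. ((T - 1) * - (W\<^sup>2)) $ l * T $ (n - l))) \<in> O(\<lambda>n. T $ (n - r))"
    proof (rule expands_upto_shifted_sum)
      fix k assume "k < r" "(T - 1) $ k \<noteq> 0"
      then have "k \<noteq> 0" using zeroth by (auto intro!: Nat.gr0I)
      then show "expands_upto (r - k) W (- (W\<^sup>2))"
        using \<open>k < r\<close> by (intro less.IH) auto
    qed
    ultimately have "(\<lambda>n. (W * (T - 1)) $ n - ((\<Sum>k<r. W $ k * (T - 1) $ (n - k)) +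
             (\<Sum>k<r. (T - 1) $ k * W $ (n - k)))
        + ((\<Sum>k<r. W $ k * (T - 1) $ (n - k)) - (\<Sum>l<r. (W * 1) $ l * T $ (n - l)))
        + ((\<Sum>k<r. (T - 1) $ k * W $ (n - k)) - (\<Sum>l<r. ((T - 1) * - (W\<^sup>2)) $ l * T $ (n - l))))
      \<in> O(\<lambda>n. T $ (n - r))"
      by (intro sum_in_bigo(1))
    \<comment> \<open>Since \<open>W * T = 1\<close>, the two contributions add up to
      \<open>W + (W\<^sup>2 - W) = W\<^sup>2\<close>; subtracting from the expansion of 1 then gives
      that of \<open>W\<close>.\<close>
    also have "W * (T - 1) = 1 - W"
      using inv by (simp add: algebra_simps)
    also have "(T - 1) * - (W\<^sup>2) = W\<^sup>2 - (W * T) * W"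
      by (simp add: algebra_simps power2_eq_square)
    also have "\<dots> = W\<^sup>2 - W"
      using inv by simp
    finally have "expands_upto r (1 - W) (W\<^sup>2)"
      unfolding expands_upto_def
      by (elim back_subst[of "\<lambda>f. f \<in> _"], intro ext)
         (simp add: left_diff_distrib sum_subtractf)
    from expands_upto_diff[OF expands_upto_1 this] show ?thesis by simp
  qed
qed

text \<open>Iterated Leibniz rule. At \<open>m = 0\<close> the truncated exponent
  \<open>m - 1\<close> is harmless because the factor \<open>of_nat m\<close> vanishes.\<close>

lemma expands_upto_power:
  assumes "\<And>r. expands_upto r A C"
  shows "expands_upto r (A ^ m) (of_nat m * A ^ (m - 1) * C)"
proof (induction m arbitrary: r)
  case 0
  show ?case using expands_upto_1[of r] by (simp only: of_nat_0 mult_zero_left power_0)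
next
  case (Suc m)
  have "A * (of_nat m * A ^ (m - 1) * C) + A ^ m * C = of_nat (Suc m) * A ^ m * C"
  proof (cases m)
    case (Suc k)
    then have "A * (of_nat m * A ^ (m - 1) * C) = of_nat m * A ^ m * C"
      by (simp only: power_Suc diff_Suc_1 mult.assoc mult.left_commute)
    then show ?thesis
      by (simp only: of_nat_Suc distrib_right mult_1 add.commute)
  qed (simp only: power_0 of_nat_0 of_nat_Suc mult_zero_left mult_zero_right add_0 add_0_right mult_1)
  then show ?case
    using expands_upto_mult[OF assms Suc, of r] by (simp only: power_Suc diff_Suc_1)
qed

end

subsection \<open>Decomposition of tournaments by the source component\<close>

text \<open>Arbitrary vertex sets are allowed because the decomposition passes to a subset and its
  complement.\<close>

definition tournaments :: "'a set \<Rightarrow> 'a rel set" where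
  "tournaments V = {A. A \<subseteq> V \<times> V \<and> (\<forall>i. (i, i) \<notin> A) \<and>
     (\<forall>i\<in>V. \<forall>j\<in>V. i \<noteq> j \<longrightarrow> (i, j) \<in> A \<or> (j, i) \<in> A)}"

text \<open>Paths may run through the whole type; when the arcs lie in \<open>V \<times> V\<close>
  this agrees with reachability inside \<open>V\<close>.\<close>

definition scc_classes :: "'a set \<Rightarrow> 'a rel \<Rightarrow> 'a set set" where
  "scc_classes V A = (\<lambda>u. {v \<in> V. (u, v) \<in> A\<^sup>* \<and> (v, u) \<in> A\<^sup>*}) ` V"

text \<open>Unordered pairs count each tie once without an order on the vertex type.\<close>

definition ties :: "'a rel \<Rightarrow> 'a set set" where
  "ties A = (\<lambda>(u, v). {u, v}) ` (A \<inter> A\<inverse>)"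

text \<open>A general function of the number of components covers the sum over all tournaments, the
  indicator of a given number, and the shift by one in the recursion.\<close>

definition weighted_sum :: "real \<Rightarrow> 'a set \<Rightarrow> (nat \<Rightarrow> real) \<Rightarrow> real" where
  "weighted_sum \<rho> V f =
     (\<Sum>A\<in>tournaments V. (\<rho> - 1) ^ card (ties A) * f (card (scc_classes V A)))"

lemma finite_tournaments: "finite V \<Longrightarrow> finite (tournaments V)"
  by (rule finite_subset[of _ "Pow (V \<times> V)"]) (auto simp: tournaments_def)

lemma tournaments_empty [simp]: "tournaments {} = {{}}"
  by (auto simp: tournaments_def)

lemma scc_classes_empty [simp]: "scc_classes {} A = {}"
  by (simp add: scc_classes_def)

lemma ties_empty [simp]: "ties {} = {}"
  by (simp add: ties_def)

lemma finite_scc_classes: "finite V \<Longrightarrow> finite (scc_classes V A)"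
  by (simp add: scc_classes_def)

lemma finite_ties: "finite V \<Longrightarrow> A \<subseteq> V \<times> V \<Longrightarrow> finite (ties A)"
  unfolding ties_def by (rule finite_imageI, rule finite_subset[of _ "V \<times> V"]) auto

lemma card_scc_classes_eq_1_iff:
  "card (scc_classes V A) = 1 \<longleftrightarrow> V \<noteq> {} \<and> (\<forall>u\<in>V. \<forall>v\<in>V. (u, v) \<in> A\<^sup>*)"
proof
  assume "card (scc_classes V A) = 1"
  then obtain C where C: "scc_classes V A = {C}"
    by (auto simp: card_1_singleton_iff)
  have "{v \<in> V. (u, v) \<in> A\<^sup>* \<and> (v, u) \<in> A\<^sup>*} \<in> scc_classes V A" if "u \<in> V" for u
    using that by (simp add: scc_classes_def)
  then have eq: "{v \<in> V. (u, v) \<in> A\<^sup>* \<and> (v, u) \<in> A\<^sup>*} = C" if "u \<in> V" for u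
    using that C by simp
  have "(u, v) \<in> A\<^sup>*" if "u \<in> V" "v \<in> V" for u v
  proof -
    have "v \<in> C" using eq[OF that(2)] that(2) by auto
    then show ?thesis using eq[OF that(1)] by auto
  qed
  moreover from C have "V \<noteq> {}" by (auto simp: scc_classes_def)
  ultimately show "V \<noteq> {} \<and> (\<forall>u\<in>V. \<forall>v\<in>V. (u, v) \<in> A\<^sup>*)"
    by simp
next
  assume V: "V \<noteq> {} \<and> (\<forall>u\<in>V. \<forall>v\<in>V. (u, v) \<in> A\<^sup>*)"
  then have "scc_classes V A = (\<lambda>u. V) ` V"
    unfolding scc_classes_def by (intro image_cong) auto
  with V show "card (scc_classes V A) = 1" by (simp add: image_constant_conv)
qed

section \<open>Invariance of weighted sums under relabelling of vertices\<close>

lemma rtrancl_map_prod_image: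
  assumes "(u, v) \<in> A\<^sup>*"
  shows "(h u, h v) \<in> (map_prod h h ` A)\<^sup>*"
  using assms by (induction rule: rtrancl_induct) (auto intro: rtrancl_into_rtrancl)

lemma rtrancl_map_prod_image_iff:
  assumes "inj_on h V" "A \<subseteq> V \<times> V" "u \<in> V" "v \<in> V"
  shows "(h u, h v) \<in> (map_prod h h ` A)\<^sup>* \<longleftrightarrow> (u, v) \<in> A\<^sup>*"
proof
  let ?g = "inv_into V h"
  assume "(h u, h v) \<in> (map_prod h h ` A)\<^sup>*"
  then have "(?g (h u), ?g (h v)) \<in> (map_prod ?g ?g ` map_prod h h ` A)\<^sup>*"
    by (rule rtrancl_map_prod_image)
  moreover have "map_prod ?g ?g ` map_prod h h ` A = A"
    using assms by (force simp: image_image map_prod_def inv_into_f_f)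
  ultimately show "(u, v) \<in> A\<^sup>*"
    using assms by simp
qed (rule rtrancl_map_prod_image)

lemma scc_classes_map_prod_image:
  assumes "inj_on h V" "A \<subseteq> V \<times> V"
  shows "scc_classes (h ` V) (map_prod h h ` A) = (`) h ` scc_classes V A"
proof -
  have "{v \<in> h ` V. (h u, v) \<in> (map_prod h h ` A)\<^sup>* \<and> (v, h u) \<in> (map_prod h h ` A)\<^sup>*}
      = h ` {v \<in> V. (u, v) \<in> A\<^sup>* \<and> (v, u) \<in> A\<^sup>*}" if "u \<in> V" for u
    using rtrancl_map_prod_image_iff[OF assms] that by blast
  then show ?thesis
    by (simp add: scc_classes_def image_image)
qed

lemma card_scc_classes_map_prod_image:
  assumes "inj_on h V" "A \<subseteq> V \<times> V"
  shows "card (scc_classes (h ` V) (map_prod h h ` A)) = card (scc_classes V A)"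
  unfolding scc_classes_map_prod_image[OF assms]
  by (rule card_image, rule inj_on_subset[OF inj_on_image_Pow[OF assms(1)]])
     (auto simp: scc_classes_def)

lemma card_ties_map_prod_image:
  assumes "inj_on h V" "A \<subseteq> V \<times> V"
  shows "card (ties (map_prod h h ` A)) = card (ties A)"
proof -
  have "map_prod h h ` A \<inter> (map_prod h h ` A)\<inverse> = map_prod h h ` (A \<inter> A\<inverse>)"
    using assms by (auto simp: inj_on_def) (metis IntI SigmaE2 converse_iff map_prod_imageI subsetD)
  then have "ties (map_prod h h ` A) = (`) h ` ties A"
    by (simp add: ties_def image_image case_prod_unfold)
  then show ?thesis
    using assms by (auto intro!: card_image inj_on_subset[OF inj_on_image_Pow[OF assms(1)]]
        simp: ties_def)
qed

lemma map_prod_image_in_tournaments: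
  assumes "inj_on h V" "A \<in> tournaments V"
  shows "map_prod h h ` A \<in> tournaments (h ` V)"
proof -
  have A: "A \<subseteq> V \<times> V" "\<And>i. (i, i) \<notin> A"
      "\<And>i j. i \<in> V \<Longrightarrow> j \<in> V \<Longrightarrow> i \<noteq> j \<Longrightarrow> (i, j) \<in> A \<or> (j, i) \<in> A"
    using assms(2) by (auto simp: tournaments_def)
  have "(i, i) \<notin> map_prod h h ` A" for i
    using A(1,2) assms(1) by (auto simp: inj_on_def)
  moreover have "(h i, h j) \<in> map_prod h h ` A \<or> (h j, h i) \<in> map_prod h h ` A"
    if "i \<in> V" "j \<in> V" "h i \<noteq> h j" for i j
    using A(3)[of i j] that by auto
  ultimately show ?thesis
    using A(1) unfolding tournaments_def by auto
qed

lemma weighted_sum_image: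
  assumes "inj_on h V"
  shows "weighted_sum \<rho> (h ` V) f = weighted_sum \<rho> V f"
proof -
  let ?g = "inv_into V h"
  have inv: "map_prod ?g ?g ` map_prod h h ` A = A" if "A \<subseteq> V \<times> V" for A
    using assms that by (force simp: image_image map_prod_def inv_into_f_f)
  have inv': "map_prod h h ` map_prod ?g ?g ` A = A" if "A \<subseteq> h ` V \<times> h ` V" for A
    using that by (force simp: image_image map_prod_def f_inv_into_f)
  have sub: "A \<subseteq> W \<times> W" if "A \<in> tournaments W" for A :: "'c rel" and W
    using that by (simp add: tournaments_def)
  have g: "inj_on ?g (h ` V)" "?g ` h ` V = V"
    using assms by (auto simp: inj_on_inv_into)
  show ?thesis
    unfolding weighted_sum_def
  proof (rule sum.reindex_bij_witness[of _ "\<lambda>A. map_prod h h ` A" "\<lambda>A. map_prod ?g ?g ` A"])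
    fix A assume A: "A \<in> tournaments (h ` V)"
    show "map_prod h h ` map_prod ?g ?g ` A = A"
      using sub[OF A] by (rule inv')
    show gA: "map_prod ?g ?g ` A \<in> tournaments V"
      using map_prod_image_in_tournaments[OF g(1) A] by (simp only: g(2))
    have "card (ties (map_prod ?g ?g ` A)) = card (ties A)"
      using g(1) sub[OF A] by (rule card_ties_map_prod_image)
    moreover have "card (scc_classes V (map_prod ?g ?g ` A)) = card (scc_classes (h ` V) A)"
      using card_scc_classes_map_prod_image[OF g(1) sub[OF A]] by (simp only: g(2))
    ultimately show "(\<rho> - 1) ^ card (ties (map_prod ?g ?g ` A)) *
        f (card (scc_classes V (map_prod ?g ?g ` A))) =
        (\<rho> - 1) ^ card (ties A) * f (card (scc_classes (h ` V) A))"
      by simp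
  next
    fix A assume A: "A \<in> tournaments V"
    show "map_prod ?g ?g ` map_prod h h ` A = A"
      using sub[OF A] by (rule inv)
    show "map_prod h h ` A \<in> tournaments (h ` V)"
      using assms A by (rule map_prod_image_in_tournaments)
  qed
qed

lemma weighted_sum_eq_card:
  assumes "finite V"
  shows "weighted_sum \<rho> V f = weighted_sum \<rho> {1..card V} f"
proof -
  obtain h where "bij_betw h {1..card V} V"
    using ex_bij_betw_nat_finite_1[OF assms] by blast
  then show ?thesis
    using weighted_sum_image[of h "{1..card V}" \<rho> f] by (auto simp: bij_betw_def)
qed

section \<open>Splitting off the source component\<close>

definition sources :: "'a set \<Rightarrow> 'a rel \<Rightarrow> 'a set" where
  "sources V A = {u \<in> V. \<forall>v\<in>V. (u, v) \<in> A\<^sup>*}"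

text \<open>The set \<open>S\<close> is closed under predecessors. Hence paths between its members
  stay inside it, no arc enters it from outside, and by totality every arc from \<open>S\<close> to
  the rest is present.\<close>

lemma tournament_split_sources:
  assumes "finite V" "V \<noteq> {}" and A: "A \<in> tournaments V"
  defines "S \<equiv> sources V A"
  shows "S \<noteq> {}"
    and "A \<inter> S \<times> S \<in> tournaments S" and "card (scc_classes S (A \<inter> S \<times> S)) = 1"
    and "A \<inter> (V - S) \<times> (V - S) \<in> tournaments (V - S)"
    and "A = (A \<inter> S \<times> S) \<union> (A \<inter> (V - S) \<times> (V - S)) \<union> S \<times> (V - S)"
proof -
  have sub: "A \<subseteq> V \<times> V" and total: "\<And>i j. i \<in> V \<Longrightarrow> j \<in> V \<Longrightarrow> i \<noteq> j \<Longrightarrow> (i, j) \<in> A \<or> (j, i) \<in> A"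
    using A by (auto simp: tournaments_def)
  show ne: "S \<noteq> {}"
  proof -
    \<comment> \<open>A vertex \<open>u\<close> with the largest reach is a source: if it missed
      \<open>v\<close>, then totality would give an arc from \<open>v\<close> to \<open>u\<close>,
      and \<open>v\<close> would reach strictly more.\<close>
    define reach where "reach = (\<lambda>u. {v \<in> V. (u, v) \<in> A\<^sup>*})"
    obtain u where u: "u \<in> V" "\<And>w. w \<in> V \<Longrightarrow> card (reach w) \<le> card (reach u)"
      using finite_has_maximal[of "(\<lambda>u. card (reach u)) ` V"] assms(1,2)
      by (force simp: not_le dest: linorder_le_cases)
    have "(u, v) \<in> A\<^sup>*" if v: "v \<in> V" for v
    proof (rule ccontr)
      assume not: "(u, v) \<notin> A\<^sup>*"
      then have "(v, u) \<in> A" using total[OF u(1) v] by auto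
      then have "insert v (reach u) \<subseteq> reach v"
        using v by (auto simp: reach_def intro: converse_rtrancl_into_rtrancl)
      moreover have "finite (reach w)" for w
        using assms(1) by (simp add: reach_def)
      ultimately have "card (insert v (reach u)) \<le> card (reach v)"
        by (intro card_mono)
      moreover have "v \<notin> reach u" using not by (simp add: reach_def)
      ultimately show False
        using u(2)[OF v] assms(1) by (simp add: reach_def)
    qed
    with u(1) show ?thesis by (auto simp: S_def sources_def)
  qed
  have reach_S: "w \<in> S" if "(w, u) \<in> A\<^sup>*" "u \<in> S" "w \<in> V" for w u
    using that by (auto simp: S_def sources_def intro: rtrancl_trans)
  have S_V: "S \<subseteq> V" by (auto simp: S_def sources_def)
  show "A \<inter> S \<times> S \<in> tournaments S" "A \<inter> (V - S) \<times> (V - S) \<in> tournaments (V - S)"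
    using A S_V unfolding tournaments_def by blast+
  show "card (scc_classes S (A \<inter> S \<times> S)) = 1"
    unfolding card_scc_classes_eq_1_iff
  proof (intro conjI ballI)
    fix u v assume u: "u \<in> S" and v: "v \<in> S"
    then have "(u, v) \<in> A\<^sup>*" using S_V by (auto simp: S_def sources_def)
    then show "(u, v) \<in> (A \<inter> S \<times> S)\<^sup>*"
      using u
    \<comment> \<open>Each intermediate vertex reaches \<open>v\<close>, which lies in
      \<open>S\<close>, so it lies in \<open>S\<close> too.\<close>
    proof (induction rule: converse_rtrancl_induct)
      case (step y z)
      then have "z \<in> S"
        using sub v by (intro reach_S[of z v]) auto
      with step show ?case
        by (intro converse_rtrancl_into_rtrancl[of y z]) auto
    qed simp
  qed (use ne in simp)
  have "S \<times> (V - S) \<subseteq> A" "A \<inter> (V - S) \<times> S = {}"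
  proof -
    have "(u, w) \<notin> A" if "u \<in> V - S" "w \<in> S" for u w
      using reach_S[of u w] that by auto
    then show "A \<inter> (V - S) \<times> S = {}" by auto
    then show "S \<times> (V - S) \<subseteq> A"
      using total S_V by blast
  qed
  then show "A = (A \<inter> S \<times> S) \<union> (A \<inter> (V - S) \<times> (V - S)) \<union> S \<times> (V - S)"
    using sub by blast
qed

text \<open>The data left by the splitting; \<open>ext\<close> glues them together again, and the
  locale shows that this inverts the splitting.\<close>

locale source_extension =
  fixes V S :: "'a set" and A\<^sub>1 A\<^sub>2 :: "'a rel"
  assumes finite_V: "finite V" and S_subset: "S \<subseteq> V"
    and A1: "A\<^sub>1 \<in> tournaments S" "card (scc_classes S A\<^sub>1) = 1"
    and A2: "A\<^sub>2 \<in> tournaments (V - S)"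
begin

definition ext :: "'a rel" where
  "ext = A\<^sub>1 \<union> A\<^sub>2 \<union> S \<times> (V - S)"

lemma S_nonempty: "S \<noteq> {}"
  and A1_connected: "u \<in> S \<Longrightarrow> v \<in> S \<Longrightarrow> (u, v) \<in> A\<^sub>1\<^sup>*"
  using A1(2) unfolding card_scc_classes_eq_1_iff by auto

lemma A1_subset: "A\<^sub>1 \<subseteq> S \<times> S" and A2_subset: "A\<^sub>2 \<subseteq> (V - S) \<times> (V - S)"
  using A1 A2 by (auto simp: tournaments_def)

lemma ext_in_tournaments: "ext \<in> tournaments V"
  using A1(1) A2 S_subset unfolding ext_def tournaments_def by auto

lemma ext_Int: "ext \<inter> S \<times> S = A\<^sub>1" "ext \<inter> (V - S) \<times> (V - S) = A\<^sub>2"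
  using A1_subset A2_subset by (auto simp: ext_def)

lemma reachable_from_S:
  assumes "u \<in> S" "v \<in> V"
  shows "(u, v) \<in> ext\<^sup>*"
proof (cases "v \<in> S")
  case True
  have "A\<^sub>1\<^sup>* \<subseteq> ext\<^sup>*" by (intro rtrancl_mono) (auto simp: ext_def)
  with True show ?thesis using A1_connected assms by blast
next
  case False
  then show ?thesis using assms by (auto simp: ext_def)
qed

text \<open>No arc leads from \<open>V - S\<close> into \<open>S\<close>, so a path that starts
  outside \<open>S\<close> uses only arcs of \<open>A\<^sub>2\<close>.\<close>

lemma reachable_outside:
  assumes "(u, v) \<in> ext\<^sup>*" "u \<in> V - S"
  shows "v \<in> V - S \<and> (u, v) \<in> A\<^sub>2\<^sup>*"
  using assms(1)
proof (induction rule: rtrancl_induct)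
  case (step y z)
  then have "(y, z) \<in> A\<^sub>2" using A1_subset by (auto simp: ext_def)
  with step.IH A2_subset show ?case by (auto intro: rtrancl_into_rtrancl)
qed (use assms in simp)

lemma reachable_outside_iff:
  assumes "u \<in> V - S"
  shows "(u, v) \<in> ext\<^sup>* \<longleftrightarrow> (u, v) \<in> A\<^sub>2\<^sup>*"
proof -
  have "A\<^sub>2\<^sup>* \<subseteq> ext\<^sup>*" by (intro rtrancl_mono) (auto simp: ext_def)
  then show ?thesis using reachable_outside[OF _ assms] by blast
qed

lemma sources_ext: "sources V ext = S"
  using S_subset S_nonempty reachable_from_S reachable_outside
  unfolding sources_def by blast

text \<open>\<open>S\<close> reaches everything and is not reached from outside, so it is a single
  class, while the classes outside are those of \<open>A\<^sub>2\<close>.\<close>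

lemma card_scc_classes_ext: "card (scc_classes V ext) = Suc (card (scc_classes (V - S) A\<^sub>2))"
proof -
  have "{v \<in> V. (u, v) \<in> ext\<^sup>* \<and> (v, u) \<in> ext\<^sup>*} = S" if "u \<in> S" for u
    using that S_subset reachable_from_S reachable_outside by blast
  moreover have "{v \<in> V. (u, v) \<in> ext\<^sup>* \<and> (v, u) \<in> ext\<^sup>*}
      = {v \<in> V - S. (u, v) \<in> A\<^sub>2\<^sup>* \<and> (v, u) \<in> A\<^sub>2\<^sup>*}" if "u \<in> V - S" for u
    using reachable_outside[OF _ that] reachable_outside_iff that by blast
  moreover have "scc_classes V ext = (\<lambda>u. {v \<in> V. (u, v) \<in> ext\<^sup>* \<and> (v, u) \<in> ext\<^sup>*}) ` (S \<union> (V - S))"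
    using S_subset by (simp add: scc_classes_def Un_absorb1)
  ultimately have "scc_classes V ext = (\<lambda>u. S) ` S \<union> scc_classes (V - S) A\<^sub>2"
    unfolding image_Un scc_classes_def by (simp cong: image_cong_simp)
  also have "(\<lambda>u. S) ` S = {S}"
    using S_nonempty by auto
  finally have "scc_classes V ext = insert S (scc_classes (V - S) A\<^sub>2)" by simp
  moreover have "S \<notin> scc_classes (V - S) A\<^sub>2"
    using S_nonempty by (auto simp: scc_classes_def)
  ultimately show ?thesis
    using finite_V by (simp add: finite_scc_classes)
qed

text \<open>The arcs from \<open>S\<close> to its complement have no reversed partner and create no
  ties, which makes the weight multiplicative.\<close>

lemma card_ties_ext: "card (ties ext) = card (ties A\<^sub>1) + card (ties A\<^sub>2)"
proof -
  have "ext \<inter> ext\<inverse> = (A\<^sub>1 \<inter> A\<^sub>1\<inverse>) \<union> (A\<^sub>2 \<inter> A\<^sub>2\<inverse>)"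
    using A1_subset A2_subset unfolding ext_def by blast
  then have "ties ext = ties A\<^sub>1 \<union> ties A\<^sub>2"
    by (simp add: ties_def image_Un)
  moreover have "ties A\<^sub>1 \<inter> ties A\<^sub>2 = {}"
  proof -
    have "e \<subseteq> S \<and> e \<noteq> {}" if "e \<in> ties A\<^sub>1" for e
      using that A1_subset by (auto simp: ties_def)
    moreover have "e \<subseteq> V - S" if "e \<in> ties A\<^sub>2" for e
      using that A2_subset by (auto simp: ties_def)
    ultimately show ?thesis by blast
  qed
  moreover have "finite (ties A\<^sub>1)" "finite (ties A\<^sub>2)"
    using finite_ties A1_subset A2_subset finite_V S_subset finite_subset
    by (metis finite_Diff)+
  ultimately show ?thesis by (simp add: card_Un_disjoint)
qed

end

text \<open>Splitting and gluing are inverse bijections between tournaments and triples. The source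
  component accounts for the \<open>Suc\<close>, and empty \<open>S\<close> contributes 0 because
  the empty tournament has no component.\<close>

lemma weighted_sum_decomposition:
  assumes V: "finite V" "V \<noteq> {}"
  shows "weighted_sum \<rho> V f =
    (\<Sum>S\<in>Pow V. weighted_sum \<rho> S (\<lambda>c. if c = 1 then 1 else 0) * weighted_sum \<rho> (V - S) (\<lambda>c. f (Suc c)))"
proof -
  let ?w = "\<lambda>A. (\<rho> - 1) ^ card (ties A)"
  let ?strong = "\<lambda>S. {A \<in> tournaments S. card (scc_classes S A) = 1}"
  let ?X = "SIGMA S:Pow V. ?strong S \<times> tournaments (V - S)"
  have fin: "finite S" if "S \<in> Pow V" for S
    using that V(1) by (auto intro: finite_subset)
  have fin_X: "finite (?strong S \<times> tournaments (V - S))" if "S \<in> Pow V" for S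
    using fin[OF that] V(1) by (simp add: finite_tournaments)
  have ext: "source_extension V S A B" if "(S, A, B) \<in> ?X" for S A B
    using that V by unfold_locales auto
  have "weighted_sum \<rho> V f = (\<Sum>(S, A, B)\<in>?X. ?w A * (?w B * f (Suc (card (scc_classes (V - S) B)))))"
    unfolding weighted_sum_def
  proof (rule sum.reindex_bij_witness[of _ "\<lambda>(S, A, B). A \<union> B \<union> S \<times> (V - S)"
        "\<lambda>A. (sources V A, A \<inter> sources V A \<times> sources V A,
               A \<inter> (V - sources V A) \<times> (V - sources V A))"])
    fix A assume A: "A \<in> tournaments V"
    define S where "S = sources V A"
    define A\<^sub>1 where "A\<^sub>1 = A \<inter> S \<times> S"
    define A\<^sub>2 where "A\<^sub>2 = A \<inter> (V - S) \<times> (V - S)"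
    note split = tournament_split_sources[OF V A, folded S_def, folded A\<^sub>1_def A\<^sub>2_def]
    show "(case (sources V A, A \<inter> sources V A \<times> sources V A,
        A \<inter> (V - sources V A) \<times> (V - sources V A)) of (S, A, B) \<Rightarrow> A \<union> B \<union> S \<times> (V - S)) = A"
      by (simp only: prod.case flip: S_def A\<^sub>1_def A\<^sub>2_def split(5))
    have mem: "(S, A\<^sub>1, A\<^sub>2) \<in> ?X"
    proof -
      have "S \<subseteq> V" by (auto simp: S_def sources_def)
      with split(2-4) show ?thesis by simp
    qed
    then show "(sources V A, A \<inter> sources V A \<times> sources V A,
        A \<inter> (V - sources V A) \<times> (V - sources V A)) \<in> ?X"
      by (simp only: S_def A\<^sub>1_def A\<^sub>2_def)
    interpret source_extension V S A\<^sub>1 A\<^sub>2 using mem by (rule ext)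
    have "ext = A" unfolding ext_def by (rule split(5)[symmetric])
    then have "?w A\<^sub>1 * (?w A\<^sub>2 * f (Suc (card (scc_classes (V - S) A\<^sub>2))))
        = ?w A * f (card (scc_classes V A))"
      using card_ties_ext card_scc_classes_ext unfolding \<open>ext = A\<close> by (simp add: power_add)
    then show "(case (sources V A, A \<inter> sources V A \<times> sources V A,
        A \<inter> (V - sources V A) \<times> (V - sources V A)) of
        (S, A, B) \<Rightarrow> ?w A * (?w B * f (Suc (card (scc_classes (V - S) B)))))
        = ?w A * f (card (scc_classes V A))"
      by (simp only: prod.case flip: S_def A\<^sub>1_def A\<^sub>2_def)
  next
    fix x assume "x \<in> ?X"
    then obtain S A\<^sub>1 A\<^sub>2 where x: "x = (S, A\<^sub>1, A\<^sub>2)" and mem: "(S, A\<^sub>1, A\<^sub>2) \<in> ?X" by blast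
    interpret source_extension V S A\<^sub>1 A\<^sub>2 using mem by (rule ext)
    have glue: "(case x of (S, A, B) \<Rightarrow> A \<union> B \<union> S \<times> (V - S)) = ext"
      by (simp add: x ext_def)
    show "(case x of (S, A, B) \<Rightarrow> A \<union> B \<union> S \<times> (V - S)) \<in> tournaments V"
      unfolding glue by (rule ext_in_tournaments)
    show "(sources V (case x of (S, A, B) \<Rightarrow> A \<union> B \<union> S \<times> (V - S)),
        (case x of (S, A, B) \<Rightarrow> A \<union> B \<union> S \<times> (V - S)) \<inter>
          sources V (case x of (S, A, B) \<Rightarrow> A \<union> B \<union> S \<times> (V - S)) \<times>
          sources V (case x of (S, A, B) \<Rightarrow> A \<union> B \<union> S \<times> (V - S)),
        (case x of (S, A, B) \<Rightarrow> A \<union> B \<union> S \<times> (V - S)) \<inter>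
          (V - sources V (case x of (S, A, B) \<Rightarrow> A \<union> B \<union> S \<times> (V - S))) \<times>
          (V - sources V (case x of (S, A, B) \<Rightarrow> A \<union> B \<union> S \<times> (V - S)))) = x"
      unfolding glue sources_ext ext_Int by (simp add: x)
  qed
  also have "\<dots> = (\<Sum>S\<in>Pow V. \<Sum>(A, B)\<in>?strong S \<times> tournaments (V - S).
      ?w A * (?w B * f (Suc (card (scc_classes (V - S) B)))))"
    using V fin_X by (intro sum.Sigma[symmetric]) auto
  also have "\<dots> = (\<Sum>S\<in>Pow V. (\<Sum>A\<in>?strong S. ?w A) * weighted_sum \<rho> (V - S) (\<lambda>c. f (Suc c)))"
    unfolding weighted_sum_def sum_product sum.cartesian_product ..
  also have "\<dots> = (\<Sum>S\<in>Pow V. weighted_sum \<rho> S (\<lambda>c. if c = 1 then 1 else 0) *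
      weighted_sum \<rho> (V - S) (\<lambda>c. f (Suc c)))"
    using fin unfolding weighted_sum_def
    by (intro sum.cong refl arg_cong2[of _ _ _ _ "(*)"] sum.mono_neutral_cong_left finite_tournaments) auto
  finally show ?thesis .
qed

section \<open>Exponential generating functions\<close>

definition weight_egf :: "real \<Rightarrow> (nat \<Rightarrow> real) \<Rightarrow> real fps" where
  "weight_egf \<rho> f = Abs_fps (\<lambda>n. weighted_sum \<rho> {1..n} f / fact n)"

text \<open>Each summand depends only on the size of \<open>S\<close>, by relabelling, so the
  subsets are grouped by cardinality.\<close>

lemma weighted_sum_decomposition_binomial:
  assumes "n > 0"
  shows "weighted_sum \<rho> {1..n} f =
    (\<Sum>k\<le>n. real (n choose k) * (weighted_sum \<rho> {1..k} (\<lambda>c. if c = 1 then 1 else 0) *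
       weighted_sum \<rho> {1..n-k} (\<lambda>c. f (Suc c))))"
proof -
  let ?g = "\<lambda>k. weighted_sum \<rho> {1..k} (\<lambda>c. if c = 1 then 1 else 0) *
       weighted_sum \<rho> {1..n-k} (\<lambda>c. f (Suc c))"
  have "weighted_sum \<rho> {1..n} f = (\<Sum>S\<in>Pow {1..n}. weighted_sum \<rho> S (\<lambda>c. if c = 1 then 1 else 0) *
      weighted_sum \<rho> ({1..n} - S) (\<lambda>c. f (Suc c)))"
    using assms by (intro weighted_sum_decomposition) auto
  also have "\<dots> = (\<Sum>S\<in>Pow {1..n}. ?g (card S))"
  proof (rule sum.cong)
    fix S assume S: "S \<in> Pow {1..n}"
    then have "finite S" by (auto intro: finite_subset)
    with S have "card ({1..n} - S) = n - card S" by (simp add: card_Diff_subset)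
    with \<open>finite S\<close> show "weighted_sum \<rho> S (\<lambda>c. if c = 1 then 1 else 0) *
      weighted_sum \<rho> ({1..n} - S) (\<lambda>c. f (Suc c)) = ?g (card S)"
      by (subst (1 2) weighted_sum_eq_card) auto
  qed simp
  also have "\<dots> = (\<Sum>k\<le>n. \<Sum>S\<in>{S \<in> Pow {1..n}. card S = k}. ?g (card S))"
    by (rule sum.group[symmetric]) (auto dest: card_mono[rotated])
  also have "\<dots> = (\<Sum>k\<le>n. real (n choose k) * ?g k)"
  proof (rule sum.cong)
    fix k
    have "card {S \<in> Pow {1..n}. card S = k} = n choose k"
      using n_subsets[of "{1..n}" k] by (simp add: Pow_def)
    then show "(\<Sum>S\<in>{S \<in> Pow {1..n}. card S = k}. ?g (card S)) = real (n choose k) * ?g k"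
      by simp
  qed simp
  finally show ?thesis .
qed


text \<open>A binomial convolution is a product of exponential generating functions. The constant
  \<open>f 0\<close> accounts for the empty tournament, at which the product vanishes.\<close>

lemma weight_egf_decomposition:
  "weight_egf \<rho> f =
     fps_const (f 0) + weight_egf \<rho> (\<lambda>c. if c = 1 then 1 else 0) * weight_egf \<rho> (\<lambda>c. f (Suc c))"
  (is "_ = _ + ?I * ?F")
proof (rule fps_ext)
  fix n
  show "weight_egf \<rho> f $ n = (fps_const (f 0) + ?I * ?F) $ n"
  proof (cases "n = 0")
    case True
    then show ?thesis by (simp add: weight_egf_def weighted_sum_def)
  next
    case False
    have "(?I * ?F) $ n = (\<Sum>k\<le>n. real (n choose k) * (weighted_sum \<rho> {1..k} (\<lambda>c. if c = 1 then 1 else 0) *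
       weighted_sum \<rho> {1..n-k} (\<lambda>c. f (Suc c))) / fact n)"
      unfolding fps_mult_nth atMost_atLeast0
      by (intro sum.cong refl) (simp add: weight_egf_def binomial_fact field_simps)
    then show ?thesis
      using False weighted_sum_decomposition_binomial[of n \<rho> f]
      by (simp add: weight_egf_def sum_divide_distrib)
  qed
qed

text \<open>Each use of the decomposition shifts the indicator of \<open>Suc m\<close> to that of
  \<open>m\<close>; for \<open>m = 0\<close> the shifted function is zero and only the constant 1
  remains.\<close>

lemma weight_egf_power:
  "weight_egf \<rho> (\<lambda>c. if c = m then 1 else 0) = weight_egf \<rho> (\<lambda>c. if c = 1 then 1 else 0) ^ m"
proof (induction m)
  case 0
  have "weight_egf \<rho> (\<lambda>c. 0) = 0"
    by (simp add: weight_egf_def weighted_sum_def fps_eq_iff)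
  then show ?case
    by (subst weight_egf_decomposition) simp
next
  case (Suc m)
  show ?case
    by (subst weight_egf_decomposition) (simp add: Suc)
qed

subsection \<open>The random model\<close>

lemma tournament_with_ties_iff:
  "tournament_with_ties n t \<longleftrightarrow> pverts t = {1..n} \<and> parcs t \<in> tournaments {1..n}"
  by (auto simp: tournament_with_ties_def tournaments_def)

lemma bij_betw_parcs: "bij_betw parcs {t. tournament_with_ties n t} (tournaments {1..n})"
  by (rule bij_betwI[where g = "\<lambda>A. \<lparr>pverts = {1..n}, parcs = A\<rparr>"])
     (auto simp: tournament_with_ties_iff)

lemma reachable_iff_rtrancl:
  assumes "A \<subseteq> V \<times> V" "u \<in> V" "v \<in> V"
  shows "(u, v) \<in> rtrancl_on V A \<longleftrightarrow> (u, v) \<in> A\<^sup>*"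
proof
  assume "(u, v) \<in> A\<^sup>*"
  then show "(u, v) \<in> rtrancl_on V A"
    by (rule rtrancl_consistent_rtrancl_on) (use assms in auto)
qed (rule rtrancl_on_rtranclI)

text \<open>\<open>num_sccs\<close> counts subgraphs. They are counted equally well by their vertex
  sets, which are the mutual reachability classes.\<close>

lemma num_sccs_eq:
  assumes "tournament_with_ties n t"
  shows "num_sccs t = card (scc_classes {1..n} (parcs t))"
proof -
  have V: "pverts t = {1..n}" and A: "parcs t \<subseteq> {1..n} \<times> {1..n}"
    using assms by (auto simp: tournament_with_ties_def)
  interpret wf_digraph "with_proj t"
    using V A by unfold_locales auto
  have "scc_of u = {v \<in> {1..n}. (u, v) \<in> (parcs t)\<^sup>* \<and> (v, u) \<in> (parcs t)\<^sup>*}"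
    if u: "u \<in> {1..n}" for u
  proof -
    have "u \<rightarrow>\<^sup>*\<^bsub>with_proj t\<^esub> v \<longleftrightarrow> v \<in> {1..n} \<and> (u, v) \<in> (parcs t)\<^sup>*" for v
      unfolding reachable_def with_proj_simps V
      using reachable_iff_rtrancl[OF A u, of v] in_rtrancl_on_in_F(2)[of u v "{1..n}" "parcs t"] by blast
    moreover have "v \<rightarrow>\<^sup>*\<^bsub>with_proj t\<^esub> u \<longleftrightarrow> v \<in> {1..n} \<and> (v, u) \<in> (parcs t)\<^sup>*" for v
      unfolding reachable_def with_proj_simps V
      using reachable_iff_rtrancl[OF A _ u, of v] in_rtrancl_on_in_F(1)[of v u "{1..n}" "parcs t"] by blast
    ultimately show ?thesis unfolding scc_of_def by auto
  qed
  then have "sccs_verts = scc_classes {1..n} (parcs t)"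
    unfolding sccs_verts_conv_scc_of scc_classes_def by (simp add: V)
  then show ?thesis
    unfolding num_sccs_def using card_sccs_verts by simp
qed

lemma strongly_connected_iff_num_sccs:
  assumes "tournament_with_ties n t"
  shows "strongly_connected (with_proj t) \<longleftrightarrow> num_sccs t = 1"
proof -
  have V: "pverts t = {1..n}" and A: "parcs t \<subseteq> {1..n} \<times> {1..n}"
    using assms by (auto simp: tournament_with_ties_def)
  show ?thesis
    unfolding num_sccs_eq[OF assms] card_scc_classes_eq_1_iff strongly_connected_def
      reachable_def with_proj_simps V
    using reachable_iff_rtrancl[OF A] by auto
qed

lemma num_ties_eq:
  assumes "tournament_with_ties n t"
  shows "num_ties t = card (ties (parcs t))"
proof -
  have irrefl: "(i, i) \<notin> parcs t" for i
    using assms by (simp add: tournament_with_ties_def)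
  let ?X = "{(i, j). i < j \<and> (i, j) \<in> parcs t \<and> (j, i) \<in> parcs t}"
  have inj: "inj_on (\<lambda>(i, j). {i, j}) ?X"
    by (auto simp: inj_on_def doubleton_eq_iff)
  have img: "(\<lambda>(i, j). {i, j}) ` ?X = ties (parcs t)"
  proof (rule subset_antisym)
    show "(\<lambda>(i, j). {i, j}) ` ?X \<subseteq> ties (parcs t)"
      by (force simp: ties_def)
    show "ties (parcs t) \<subseteq> (\<lambda>(i, j). {i, j}) ` ?X"
    proof
      fix e assume "e \<in> ties (parcs t)"
      then obtain i j where e: "e = {i, j}" "(i, j) \<in> parcs t" "(j, i) \<in> parcs t"
        by (auto simp: ties_def)
      show "e \<in> (\<lambda>(i, j). {i, j}) ` ?X"
      proof (cases i j rule: linorder_cases)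
        case less
        with e show ?thesis by (intro image_eqI[of _ _ "(i, j)"]) auto
      next
        case equal
        with e irrefl show ?thesis by simp
      next
        case greater
        with e show ?thesis by (intro image_eqI[of _ _ "(j, i)"]) auto
      qed
    qed
  qed
  show ?thesis
    using card_image[OF inj] unfolding img num_ties_def by simp
qed

lemma sum_tournament_weight:
  "(\<Sum>t | tournament_with_ties n t \<and> P (num_sccs t). tournament_weight \<rho> t)
     = weighted_sum \<rho> {1..n} (\<lambda>c. if P c then 1 else 0)"
proof -
  have fin: "finite {t. tournament_with_ties n t}"
    using bij_betw_finite[OF bij_betw_parcs] by (simp add: finite_tournaments)
  have "weighted_sum \<rho> {1..n} (\<lambda>c. if P c then 1 else 0)
      = (\<Sum>t | tournament_with_ties n t. (\<rho> - 1) ^ card (ties (parcs t)) *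
          (if P (card (scc_classes {1..n} (parcs t))) then 1 else 0))"
    unfolding weighted_sum_def by (rule sum.reindex_bij_betw[OF bij_betw_parcs, symmetric])
  also have "\<dots> = (\<Sum>t | tournament_with_ties n t. if P (num_sccs t) then tournament_weight \<rho> t else 0)"
    by (intro sum.cong refl) (simp add: num_sccs_eq num_ties_eq tournament_weight_def)
  also have "\<dots> = (\<Sum>t | tournament_with_ties n t \<and> P (num_sccs t). tournament_weight \<rho> t)"
    using fin by (simp add: sum.If_cases Int_def)
  finally show ?thesis ..
qed

text \<open>The convention for \<open>j = 0\<close> agrees with honest counting, since only the
  empty tournament has no component.\<close>

lemma tournament_weight_sum_eq:
  "\<ii>\<tt> \<rho> j k = weighted_sum \<rho> {1..k} (\<lambda>c. if c = j then 1 else 0)"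
proof (cases "j = 0")
  case True
  show ?thesis
  proof (cases "k = 0")
    case False
    then have "card (scc_classes {1..k} A) \<noteq> 0" for A
      using finite_scc_classes[of "{1..k}" A] by (auto simp: scc_classes_def)
    with True False show ?thesis
      by (simp add: tournament_weight_sum_def weighted_sum_def del: neq0_conv)
  qed (simp add: True tournament_weight_sum_def weighted_sum_def)
next
  case False
  then show ?thesis
    using sum_tournament_weight[where n = k and P = "\<lambda>c. c = j" and \<rho> = \<rho>] by (simp add: tournament_weight_sum_def)
qed

section \<open>The product distribution on arc choices\<close>

lemma finite_vertex_pairs: "finite (vertex_pairs n)"
  by (rule finite_subset[of _ "{1..n} \<times> {1..n}"]) (auto simp: vertex_pairs_def)

lemma card_vertex_pairs: "card (vertex_pairs n) = n choose 2"
proof (induction n)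
  case 0
  have "vertex_pairs 0 = {}" by (auto simp: vertex_pairs_def)
  then show ?case by simp
next
  case (Suc n)
  have "vertex_pairs (Suc n) = vertex_pairs n \<union> (\<lambda>i. (i, Suc n)) ` {1..n}"
    by (auto simp: vertex_pairs_def)
  moreover have "vertex_pairs n \<inter> (\<lambda>i. (i, Suc n)) ` {1..n} = {}"
    by (auto simp: vertex_pairs_def)
  moreover have "card ((\<lambda>i. (i, Suc n)) ` {1..n}) = n"
    by (subst card_image) (auto simp: inj_on_def)
  ultimately have "card (vertex_pairs (Suc n)) = (n choose 2) + n"
    using Suc by (simp add: card_Un_disjoint finite_vertex_pairs)
  then show ?case by (simp add: numeral_2_eq_2)
qed

text \<open>Contains the support of the product distribution. The value \<open>{}\<close> outside
  \<open>vertex_pairs n\<close> is the default of \<open>Pi_pmf\<close> and makes a choice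
  recoverable from its graph.\<close>

definition arc_choices :: "nat \<Rightarrow> (nat \<times> nat \<Rightarrow> (nat \<times> nat) set) set" where
  "arc_choices n = {f. (\<forall>e. e \<notin> vertex_pairs n \<longrightarrow> f e = {}) \<and>
     (\<forall>i j. (i, j) \<in> vertex_pairs n \<longrightarrow>
        f (i, j) = {(i, j)} \<or> f (i, j) = {(j, i)} \<or> f (i, j) = {(i, j), (j, i)})}"

definition graph_of :: "nat \<Rightarrow> (nat \<times> nat \<Rightarrow> (nat \<times> nat) set) \<Rightarrow> nat pair_pre_digraph" where
  "graph_of n f = \<lparr>pverts = {1..n}, parcs = (\<Union>e\<in>vertex_pairs n. f e)\<rparr>"

definition choice_of :: "nat \<Rightarrow> nat pair_pre_digraph \<Rightarrow> nat \<times> nat \<Rightarrow> (nat \<times> nat) set" where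
  "choice_of n t = (\<lambda>(i, j). if (i, j) \<in> vertex_pairs n then parcs t \<inter> {(i, j), (j, i)} else {})"

lemma arc_choices_cases:
  assumes "f \<in> arc_choices n" "(i, j) \<in> vertex_pairs n"
  shows "f (i, j) = {(i, j)} \<or> f (i, j) = {(j, i)} \<or> f (i, j) = {(i, j), (j, i)}"
  using assms by (simp add: arc_choices_def)

lemma graph_of_tournament:
  assumes f: "f \<in> arc_choices n"
  shows "tournament_with_ties n (graph_of n f)"
proof -
  have sub: "f (i, j) \<subseteq> {(i, j), (j, i)}" if "(i, j) \<in> vertex_pairs n" for i j
    using arc_choices_cases[OF f that] by (elim disjE) simp_all
  have bounds: "x \<in> {1..n} \<and> y \<in> {1..n} \<and> x \<noteq> y" if "(x, y) \<in> parcs (graph_of n f)" for x y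
  proof -
    from that obtain i j where ij: "(i, j) \<in> vertex_pairs n" "(x, y) \<in> f (i, j)"
      by (auto simp: graph_of_def)
    then have "(x, y) \<in> {(i, j), (j, i)}" using sub by blast
    with ij(1) show ?thesis by (auto simp: vertex_pairs_def)
  qed
  have total: "(i, j) \<in> parcs (graph_of n f) \<or> (j, i) \<in> parcs (graph_of n f)"
    if "(i, j) \<in> vertex_pairs n" for i j
  proof -
    have "(i, j) \<in> f (i, j) \<or> (j, i) \<in> f (i, j)"
      using arc_choices_cases[OF f that] by (elim disjE) simp_all
    with that show ?thesis unfolding graph_of_def by force
  qed
  show ?thesis
    unfolding tournament_with_ties_def
  proof (intro conjI allI ballI impI)
    show "pverts (graph_of n f) = {1..n}" by (simp add: graph_of_def)
    show "parcs (graph_of n f) \<subseteq> {1..n} \<times> {1..n}"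
      using bounds by (intro subrelI) simp
    show "(i, i) \<notin> parcs (graph_of n f)" for i
      using bounds[of i i] by auto
    show "(i, j) \<in> parcs (graph_of n f) \<or> (j, i) \<in> parcs (graph_of n f)"
      if "i \<in> {1..n}" "j \<in> {1..n}" "i \<noteq> j" for i j
      using that total[of i j] total[of j i] by (cases "i < j") (auto simp: vertex_pairs_def)
  qed
qed

lemma choice_of_graph_of:
  assumes f: "f \<in> arc_choices n"
  shows "choice_of n (graph_of n f) = f"
proof (intro ext, clarify)
  fix i j
  show "choice_of n (graph_of n f) (i, j) = f (i, j)"
  proof (cases "(i, j) \<in> vertex_pairs n")
    case True
    have "(\<Union>e\<in>vertex_pairs n. f e) \<inter> {(i, j), (j, i)} \<subseteq> f (i, j)"
    proof
      fix x assume "x \<in> (\<Union>e\<in>vertex_pairs n. f e) \<inter> {(i, j), (j, i)}"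
      then obtain i' j' where x: "(i', j') \<in> vertex_pairs n" "x \<in> f (i', j')" "x \<in> {(i, j), (j, i)}"
        by auto
      then have "x \<in> {(i', j'), (j', i')}"
        using arc_choices_cases[OF f x(1)] by (elim disjE) simp_all
      \<comment> \<open>Both pairs are increasing, so sharing an arc up to orientation forces them
        to be equal.\<close>
      with x True have "(i', j') = (i, j)"
        by (auto simp: vertex_pairs_def)
      with x show "x \<in> f (i, j)" by simp
    qed
    moreover have "f (i, j) \<subseteq> {(i, j), (j, i)}"
      using arc_choices_cases[OF f True] by (elim disjE) simp_all
    ultimately show ?thesis
      using True by (auto simp: choice_of_def graph_of_def)
  next
    case False
    then show ?thesis using f by (simp add: choice_of_def arc_choices_def)
  qed
qed

lemma graph_of_choice_of:
  assumes "tournament_with_ties n t"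
  shows "graph_of n (choice_of n t) = t"
proof -
  have "(\<Union>e\<in>vertex_pairs n. choice_of n t e) = parcs t"
  proof (rule subset_antisym; rule subrelI)
    fix x y assume xy: "(x, y) \<in> parcs t"
    then have "x \<noteq> y" "x \<in> {1..n}" "y \<in> {1..n}"
      using assms by (auto simp: tournament_with_ties_def)
    then have "(x, y) \<in> vertex_pairs n \<or> (y, x) \<in> vertex_pairs n"
      by (auto simp: vertex_pairs_def)
    with xy show "(x, y) \<in> (\<Union>e\<in>vertex_pairs n. choice_of n t e)"
      by (auto simp: choice_of_def intro: rev_bexI)
  qed (auto simp: choice_of_def split: if_splits)
  with assms show ?thesis
    by (simp add: graph_of_def tournament_with_ties_def)
qed

context
  fixes p :: real
  assumes p: "1/2 \<le> p" "p < 1"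
begin

lemma pmf_random_arcs:
  assumes "i \<noteq> j"
  shows "pmf (random_arcs p i j) X =
    (if X = {(i, j)} \<or> X = {(j, i)} then 1 - p
     else if X = {(i, j), (j, i)} then p - (1 - p) else 0)"
  using assms p random_arcs_wf[of p i j]
  by (auto simp: random_arcs_def Let_def pmf_pmf_of_list doubleton_eq_iff)

lemma set_random_arcs: "set_pmf (random_arcs p i j) \<subseteq> {{(i, j)}, {(j, i)}, {(i, j), (j, i)}}"
  using p set_pmf_of_list[OF random_arcs_wf[of p i j]] by (simp add: random_arcs_def Let_def)

abbreviation choice_pmf :: "nat \<Rightarrow> (nat \<times> nat \<Rightarrow> (nat \<times> nat) set) pmf" where
  "choice_pmf n \<equiv> Pi_pmf (vertex_pairs n) {} (\<lambda>(i, j). random_arcs p i j)"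

lemma random_tournament_eq: "random_tournament n p = map_pmf (graph_of n) (choice_pmf n)"
  unfolding random_tournament_def graph_of_def ..

lemma set_choice_pmf: "set_pmf (choice_pmf n) \<subseteq> arc_choices n"
proof
  fix f assume "f \<in> set_pmf (choice_pmf n)"
  then have f: "f \<in> PiE_dflt (vertex_pairs n) {} (set_pmf \<circ> (\<lambda>(i, j). random_arcs p i j))"
    by (rule set_mp[OF set_Pi_pmf_subset'[OF finite_vertex_pairs]])
  have "f (i, j) = {(i, j)} \<or> f (i, j) = {(j, i)} \<or> f (i, j) = {(i, j), (j, i)}"
    if "(i, j) \<in> vertex_pairs n" for i j
  proof -
    have "f (i, j) \<in> set_pmf (random_arcs p i j)"
      using f that unfolding PiE_dflt_def by auto
    then show ?thesis using set_random_arcs[of i j] by blast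
  qed
  with f show "f \<in> arc_choices n"
    by (auto simp: arc_choices_def PiE_dflt_def)
qed

text \<open>With \<open>q = 1 - p\<close>, taking a factor \<open>q\<close> out of each of the
  \<open>n choose 2\<close> pairs leaves 1 for a single arc and
  \<open>(p - q) / q = \<rho> - 1\<close> for a tie, which is the weight.\<close>

lemma pmf_choice_of:
  assumes t: "tournament_with_ties n t"
  shows "pmf (choice_pmf n) (choice_of n t) = (1 - p) ^ (n choose 2) * tournament_weight (p / (1 - p)) t"
proof -
  let ?tie = "\<lambda>e. e \<in> parcs t \<and> prod.swap e \<in> parcs t"
  have "pmf (choice_pmf n) (choice_of n t)
      = (\<Prod>e\<in>vertex_pairs n. pmf (case e of (i, j) \<Rightarrow> random_arcs p i j) (choice_of n t e))"
    by (rule pmf_Pi'[OF finite_vertex_pairs]) (auto simp: choice_of_def)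
  also have "\<dots> = (\<Prod>e\<in>vertex_pairs n. (1 - p) * (if ?tie e then p / (1 - p) - 1 else 1))"
  proof (rule prod.cong, simp, clarify)
    fix i j assume ij: "(i, j) \<in> vertex_pairs n"
    then have "i \<noteq> j" and "(i, j) \<in> parcs t \<or> (j, i) \<in> parcs t"
      using t by (auto simp: vertex_pairs_def tournament_with_ties_def)
    moreover have "(1 - p) * (p / (1 - p) - 1) = p - (1 - p)"
      using p by (simp add: right_diff_distrib)
    ultimately show "pmf (random_arcs p i j) (choice_of n t (i, j)) =
        (1 - p) * (if ?tie (i, j) then p / (1 - p) - 1 else 1)"
      using ij by (cases "(i, j) \<in> parcs t"; cases "(j, i) \<in> parcs t")
        (auto simp: pmf_random_arcs choice_of_def)
  qed
  also have "\<dots> = (1 - p) ^ (n choose 2) * (p / (1 - p) - 1) ^ card {e \<in> vertex_pairs n. ?tie e}"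
    by (simp add: prod.distrib card_vertex_pairs prod.If_cases finite_vertex_pairs Int_def)
  also have "{e \<in> vertex_pairs n. ?tie e} = {(i, j). i < j \<and> (i, j) \<in> parcs t \<and> (j, i) \<in> parcs t}"
    using t by (auto simp: vertex_pairs_def tournament_with_ties_def)
  finally show ?thesis
    by (simp add: tournament_weight_def num_ties_def)
qed

lemma set_random_tournament:
  assumes "t \<in> set_pmf (random_tournament n p)"
  shows "tournament_with_ties n t"
  using assms set_choice_pmf graph_of_tournament unfolding random_tournament_eq by auto

text \<open>Almost surely the choice lies in \<open>arc_choices n\<close>, on which
  \<open>graph_of\<close> is injective, so the fibre over \<open>t\<close> is a single choice up to
  a null set.\<close>

lemma pmf_random_tournament:
  assumes t: "tournament_with_ties n t"
  shows "pmf (random_tournament n p) t = (1 - p) ^ (n choose 2) * tournament_weight (p / (1 - p)) t"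
proof -
  have "pmf (random_tournament n p) t = measure_pmf.prob (choice_pmf n) (graph_of n -` {t})"
    unfolding random_tournament_eq by (rule pmf_map)
  also have "\<dots> = measure_pmf.prob (choice_pmf n) {choice_of n t}"
  proof (rule measure_pmf.finite_measure_eq_AE)
    have "graph_of n f = t \<longleftrightarrow> f = choice_of n t" if "f \<in> arc_choices n" for f
      using choice_of_graph_of[OF that] graph_of_choice_of[OF t] by auto
    then show "AE f in measure_pmf (choice_pmf n). f \<in> graph_of n -` {t} \<longleftrightarrow> f \<in> {choice_of n t}"
      using set_choice_pmf by (auto simp: AE_measure_pmf_iff)
  qed auto
  finally show ?thesis
    using pmf_choice_of[OF t] by (simp add: measure_pmf_single)
qed

lemma prob_num_sccs:
  "measure_pmf.prob (random_tournament n p) {t. P (num_sccs t)} =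
     (1 - p) ^ (n choose 2) * weighted_sum (p / (1 - p)) {1..n} (\<lambda>c. if P c then 1 else 0)"
proof -
  let ?X = "{t. tournament_with_ties n t \<and> P (num_sccs t)}"
  have "finite {t. tournament_with_ties n t}"
    using bij_betw_finite[OF bij_betw_parcs] by (simp add: finite_tournaments)
  then have "finite ?X" by (rule rev_finite_subset) auto
  have "measure_pmf.prob (random_tournament n p) {t. P (num_sccs t)}
      = measure_pmf.prob (random_tournament n p) ?X"
    by (rule measure_pmf.finite_measure_eq_AE)
       (auto simp: AE_measure_pmf_iff dest: set_random_tournament)
  also have "\<dots> = (\<Sum>t\<in>?X. pmf (random_tournament n p) t)"
    using \<open>finite ?X\<close> by (rule measure_measure_pmf_finite)
  also have "\<dots> = (1 - p) ^ (n choose 2) * (\<Sum>t\<in>?X. tournament_weight (p / (1 - p)) t)"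
    by (simp add: pmf_random_tournament sum_distrib_left)
  finally show ?thesis by (simp only: sum_tournament_weight)
qed

text \<open>Total probability 1 evaluates the sum of all weights.\<close>

lemma weighted_sum_one: "weighted_sum (p / (1 - p)) {1..n} (\<lambda>c. 1) = 1 / (1 - p) ^ (n choose 2)"
  using prob_num_sccs[of n "\<lambda>_. True"] p by (simp add: field_simps)

lemma prob_strongly_connected:
  "measure_pmf.prob (random_tournament n p) {t. strongly_connected (with_proj t)} =
   measure_pmf.prob (random_tournament n p) {t. num_sccs t = 1}"
  by (rule measure_pmf.finite_measure_eq_AE)
     (auto simp: AE_measure_pmf_iff strongly_connected_iff_num_sccs dest!: set_random_tournament)

end

subsection \<open>The expansion\<close>

text \<open>The exponent identity behind \<open>expansion_scale_eq\<close>, with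
  \<open>l = n - k\<close> to avoid truncated subtraction.\<close>

lemma choose_two_add:
  "(k + l) * k + (l choose 2) = ((k + l) choose 2) + k * (k + 1) div 2"
proof (induction k)
  case (Suc k)
  have "Suc k * (Suc k + 1) = k * (k + 1) + Suc k * 2" by simp
  then have "Suc k * (Suc k + 1) div 2 = k * (k + 1) div 2 + Suc k"
    by (simp only: div_mult_self1)
  moreover have "(Suc k + l choose 2) = (k + l choose 2) + (k + l)"
    by (simp add: numeral_2_eq_2)
  ultimately show ?case using Suc by (simp add: algebra_simps)
qed simp

context
  fixes q :: real and T :: "real fps"
  assumes q: "0 < q" "q \<le> 1/2"
    and T: "\<And>n. T $ n = 1 / (q ^ (n choose 2) * fact n)"
begin

text \<open>For \<open>k > n\<close> the left side is 0 but truncated subtraction keeps the right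
  side positive, so later uses hold only eventually in \<open>n\<close>.\<close>

lemma expansion_scale_eq:
  assumes "k \<le> n"
  shows "expansion_scale q k n = T $ (n - k) / (T $ n * fact k)"
proof -
  obtain l where n: "n = k + l" using assms le_Suc_ex by blast
  have "q ^ (n * k) * q ^ (l choose 2) = q ^ (n choose 2) * q ^ (k * (k + 1) div 2)"
    unfolding n power_add[symmetric] choose_two_add ..
  then have "q ^ (n * k) / q ^ (k * (k + 1) div 2) = q ^ (n choose 2) / q ^ (l choose 2)"
    using q by (simp add: field_simps)
  moreover have "real (n choose k) = fact n / (fact k * fact l)"
    by (simp add: n binomial_fact)
  ultimately show ?thesis
    by (simp add: expansion_scale_def T n mult_ac)
qed

text \<open>The ratio of successive coefficients is \<open>1 / (q ^ n * (n + 1))\<close>.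
  Log-convexity amounts to \<open>q * (n + 2) \<le> n + 1\<close>, which for \<open>n = 0\<close> is
  exactly \<open>q \<le> 1/2\<close>, and \<open>growth\<close> says that
  \<open>n * (n + 1) * q ^ n\<close> is bounded.\<close>

lemma fast_growing_T: "fast_growing_fps T"
proof
  have T_Suc: "T $ Suc n = T $ n / (q ^ n * real (Suc n))" for n
    unfolding T by (simp add: numeral_2_eq_2 power_add)
  show pos: "T $ n > 0" for n
    using q by (simp add: T)
  show "T $ 0 = 1" by (simp add: T numeral_2_eq_2)
  show "(T $ Suc n)\<^sup>2 \<le> T $ n * T $ Suc (Suc n)" for n
  proof -
    have "q * real (Suc (Suc n)) \<le> 1/2 * real (Suc (Suc n))"
      using q by (intro mult_right_mono) auto
    also have "\<dots> \<le> real (Suc n)" by simp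
    finally have "q ^ Suc n * real (Suc (Suc n)) \<le> q ^ n * real (Suc n)"
      using q by (simp add: mult_ac)
    then have "T $ Suc n * (T $ n / (q ^ n * real (Suc n)))
        \<le> T $ Suc n * (T $ n / (q ^ Suc n * real (Suc (Suc n))))"
      using q pos by (intro mult_left_mono divide_left_mono) (auto intro: less_imp_le)
    then show ?thesis
      by (simp only: T_Suc[of "Suc n"] T_Suc[of n, symmetric] power2_eq_square)
         (simp add: mult_ac)
  qed
  have "(\<lambda>n. real n * real (Suc n) * q ^ n) \<in> O(\<lambda>n. real n * real (Suc n) * (1/2) ^ n)"
    using q by (intro landau_o.big.mult landau_o.big_refl bigoI[of _ 1] always_eventually allI)
      (auto intro!: power_mono simp flip: power_divide)
  also have "(\<lambda>n. real n * real (Suc n) * (1/2) ^ n) \<in> O(\<lambda>_. 1)"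
    by real_asymp
  finally have "(\<lambda>n. real n * real (Suc n) * q ^ n * T $ Suc n) \<in> O(\<lambda>n. 1 * T $ Suc n)"
    by (intro landau_o.big.mult landau_o.big_refl)
  then show "(\<lambda>n. real n * T $ n) \<in> O(\<lambda>n. T $ Suc n)"
    using q by (simp add: T_Suc mult_ac del: of_nat_Suc)
qed

interpretation fast_growing_fps T by (rule fast_growing_T)

lemma expansion_scale_bigtheta: "expansion_scale q k \<in> \<Theta>(\<lambda>n. T $ (n - k) * (1 / T $ n))"
proof -
  have "expansion_scale q k \<in> \<Theta>(\<lambda>n. (1 / fact k) * (T $ (n - k) * (1 / T $ n)))"
    by (intro bigthetaI_cong eventually_mono[OF eventually_ge_at_top[of k]])
       (simp add: expansion_scale_eq)
  also have "\<Theta>(\<lambda>n. (1 / fact k) * (T $ (n - k) * (1 / T $ n))) = \<Theta>(\<lambda>n. T $ (n - k) * (1 / T $ n))"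
    by (rule landau_theta.cmult) simp
  finally show ?thesis .
qed

lemma expansion_scale_smallo: "expansion_scale q (Suc k) \<in> o(expansion_scale q k)"
proof -
  have "expansion_scale q (Suc k) \<in> \<Theta>(\<lambda>n. T $ (n - Suc k) * (1 / T $ n))"
    by (rule expansion_scale_bigtheta)
  also have "(\<lambda>n. T $ (n - Suc k) * (1 / T $ n)) \<in> o(\<lambda>n. T $ (n - k) * (1 / T $ n))"
    by (intro landau_o.small_big_mult smallo_shift landau_o.big_refl)
  also have "(\<lambda>n. T $ (n - k) * (1 / T $ n)) \<in> \<Theta>(expansion_scale q k)"
    using expansion_scale_bigtheta by (rule bigtheta_sym[THEN iffD1])
  finally show ?thesis .
qed

text \<open>Dividing by \<open>T $ n\<close> turns \<open>T $ (n - k)\<close> into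
  \<open>fact k\<close> times the scale. Sums up to and including \<open>r\<close> correspond to
  order \<open>Suc r\<close> of \<open>expands_upto\<close>.\<close>

lemma has_expansion_if_expands_upto:
  assumes A: "\<And>r. expands_upto r A C"
  shows "has_expansion (\<lambda>n. A $ n / T $ n) (\<lambda>k. fact k * C $ k) (expansion_scale q)"
  unfolding has_expansion_def
proof (intro conjI allI)
  show "expansion_scale q (Suc k) \<in> o(expansion_scale q k)" for k
    by (rule expansion_scale_smallo)
  fix r
  have "(\<lambda>n. (A $ n - (\<Sum>k<Suc r. C $ k * T $ (n - k))) * (1 / T $ n))
      \<in> O(\<lambda>n. T $ (n - Suc r) * (1 / T $ n))"
    using A[of "Suc r"] unfolding expands_upto_def by (intro landau_o.big.mult landau_o.big_refl)
  also have "(\<lambda>n. T $ (n - Suc r) * (1 / T $ n)) \<in> \<Theta>(expansion_scale q (Suc r))"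
    using expansion_scale_bigtheta by (rule bigtheta_sym[THEN iffD1])
  also have "(\<lambda>n. (A $ n - (\<Sum>k<Suc r. C $ k * T $ (n - k))) * (1 / T $ n))
      \<in> O(expansion_scale q (Suc r)) \<longleftrightarrow>
    (\<lambda>n. A $ n / T $ n - (\<Sum>k\<le>r. fact k * C $ k * expansion_scale q k n))
      \<in> O(expansion_scale q (Suc r))"
  proof (intro landau_o.big.in_cong eventually_mono[OF eventually_ge_at_top[of r]])
    fix n assume "r \<le> n"
    then have "(\<Sum>k\<le>r. fact k * C $ k * expansion_scale q k n)
        = (\<Sum>k<Suc r. C $ k * T $ (n - k) * (1 / T $ n))"
      unfolding lessThan_Suc_atMost by (intro sum.cong) (simp_all add: expansion_scale_eq)
    then show "(A $ n - (\<Sum>k<Suc r. C $ k * T $ (n - k))) * (1 / T $ n)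
        = A $ n / T $ n - (\<Sum>k\<le>r. fact k * C $ k * expansion_scale q k n)"
      by (simp only: left_diff_distrib sum_distrib_right) simp
  qed
  finally show "(\<lambda>n. A $ n / T $ n - (\<Sum>k\<le>r. fact k * C $ k * expansion_scale q k n))
      \<in> O(expansion_scale q (Suc r))" .
qed

text \<open>The reciprocal rule for \<open>W = 1 - I\<close> gives \<open>I\<close> the expansion
  \<open>W\<^sup>2\<close>; the power rule does the rest. The coefficientwise bounds on
  \<open>I\<close> supply the growth condition on \<open>W\<close>.\<close>

lemma expands_upto_power_of_reciprocal:
  fixes I :: "real fps"
  assumes I: "(1 - I) * T = 1" "\<And>n. 0 \<le> I $ n" "\<And>n. I $ n \<le> T $ n"
  shows "expands_upto r (I ^ m) (of_nat m * I ^ (m - 1) * (1 - I)\<^sup>2)"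
proof (rule expands_upto_power)
  fix r
  have "(\<lambda>n. I $ n) \<in> O(\<lambda>n. T $ n)"
    using I by (intro bigoI[of _ 1] always_eventually allI)
      (simp, meson abs_ge_self order_trans)
  then have "(\<lambda>n. (1 - I) $ n) \<in> O(\<lambda>n. T $ n)"
    using expands_upto_diff[OF expands_upto_1[of 0], of I 0] by (simp add: expands_upto_0)
  from expands_upto_diff[OF expands_upto_1 expands_upto_reciprocal[OF I(1) this]]
  show "expands_upto r I ((1 - I)\<^sup>2)" by simp
qed

end

theorem corollary4p10:
  fixes p q \<rho> :: real and m :: nat
  assumes "1 \<le> m"
    and "1/2 \<le> p" and "p < 1"
    and "q = 1 - p" and "\<rho> = p / q"
  shows "has_expansion
           (\<lambda>n. measure_pmf.prob (random_tournament n p) {t. num_sccs t = m})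
           (\<lambda>k. scc_coeff \<rho> m k)
           (expansion_scale q)
       \<and> has_expansion
           (\<lambda>n. measure_pmf.prob (random_tournament n p) {t. strongly_connected (with_proj t)})
           (\<lambda>k. (if k = 0 then 1 else 0) - (2 * \<ii>\<tt> \<rho> 1 k - \<ii>\<tt> \<rho> 2 k))
           (expansion_scale q)"
proof -
  define T where "T = weight_egf \<rho> (\<lambda>_. 1)"
  define I where "I = weight_egf \<rho> (\<lambda>c. if c = 1 then 1 else 0)"
  have p: "1/2 \<le> p" "p < 1" and q: "0 < q" "q \<le> 1/2"
    using assms by auto
  \<comment> \<open>\<open>\<rho> \<ge> 1\<close> makes all weights nonnegative, whence
    \<open>0 \<le> I $ n \<le> T $ n\<close>.\<close>
  have \<rho>: "\<rho> \<ge> 1" "\<rho> = p / (1 - p)"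
    using p assms(4,5) by simp_all
  have T_nth: "T $ n = 1 / (q ^ (n choose 2) * fact n)" for n
    using weighted_sum_one[OF p, of n] by (simp add: T_def weight_egf_def assms)
  have inv: "(1 - I) * T = 1"
    using weight_egf_decomposition[of \<rho> "\<lambda>_. 1"] by (simp add: T_def I_def algebra_simps)
  have nonneg: "0 \<le> I $ n" for n
    using \<rho>(1) by (auto simp: I_def weight_egf_def weighted_sum_def intro!: divide_nonneg_pos sum_nonneg)
  have le: "I $ n \<le> T $ n" for n
    using \<rho>(1) by (auto simp: I_def T_def weight_egf_def weighted_sum_def intro!: divide_right_mono sum_mono)
  have it: "\<ii>\<tt> \<rho> j k = fact k * (I ^ j) $ k" for j k
    unfolding I_def weight_egf_power[symmetric]
    by (simp add: weight_egf_def tournament_weight_sum_eq)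
  \<comment> \<open>Stated for every positive \<open>m\<close>, since strong connectivity is the
    case \<open>m = 1\<close>.\<close>
  have main: "has_expansion
           (\<lambda>n. measure_pmf.prob (random_tournament n p) {t. num_sccs t = m})
           (\<lambda>k. scc_coeff \<rho> m k) (expansion_scale q)" if m: "1 \<le> m" for m
  proof -
    have "has_expansion (\<lambda>n. (I ^ m) $ n / T $ n)
        (\<lambda>k. fact k * (of_nat m * I ^ (m - 1) * (1 - I)\<^sup>2) $ k) (expansion_scale q)"
      using has_expansion_if_expands_upto[OF q T_nth
        expands_upto_power_of_reciprocal[OF q T_nth inv nonneg le]] .
    moreover have "(I ^ m) $ n / T $ n = measure_pmf.prob (random_tournament n p) {t. num_sccs t = m}" for n
      using prob_num_sccs[OF p, of n "\<lambda>c. c = m"] it[of m n]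
      by (simp add: T_nth tournament_weight_sum_eq assms(4) \<rho>(2) mult_ac)
    moreover have "fact k * (of_nat m * I ^ (m - 1) * (1 - I)\<^sup>2) $ k = scc_coeff \<rho> m k" for k
    proof -
      \<comment> \<open>Expanding \<open>(1 - I)\<^sup>2\<close> produces the three neighbouring
        powers of \<open>I\<close> in the coefficient; \<open>m = Suc j\<close> removes the
        truncated \<open>m - 1\<close>.\<close>
      obtain j where j: "m = Suc j" using m by (cases m) auto
      have "of_nat m * I ^ (m - 1) * (1 - I)\<^sup>2
          = of_nat m * (I ^ (m - 1) - 2 * I ^ m + I ^ (m + 1))"
        by (simp add: j power2_eq_square algebra_simps)
      also have "\<dots> = fps_const (real m) * (I ^ (m - 1) - fps_const 2 * I ^ m + I ^ (m + 1))"
        by (simp only: fps_of_nat numeral_fps_const)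
      finally have eq: "of_nat m * I ^ (m - 1) * (1 - I)\<^sup>2
          = fps_const (real m) * (I ^ (m - 1) - fps_const 2 * I ^ m + I ^ (m + 1))" .
      show ?thesis
        unfolding scc_coeff_def it eq fps_mult_left_const_nth fps_add_nth fps_sub_nth
        by (simp add: algebra_simps)
    qed
    ultimately show ?thesis by simp
  qed
  \<comment> \<open>For \<open>m = 1\<close> the term with index \<open>m - 1 = 0\<close> is the
    indicator of \<open>k = 0\<close>, which is the leading 1 of the second expansion.\<close>
  have "scc_coeff \<rho> 1 = (\<lambda>k. (if k = 0 then 1 else 0) - (2 * \<ii>\<tt> \<rho> 1 k - \<ii>\<tt> \<rho> 2 k))"
    by (rule ext) (simp add: scc_coeff_def it[of 0] numeral_2_eq_2)
  then show ?thesis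
    using main[OF assms(1)] main[of 1] by (simp only: prob_strongly_connected[OF p] order_refl simp_thms)
qed

end
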